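(* Let $\Lambda$ be a $k$-graph. The sequence of $\Lambda$-module maps $\big(\triangledown_n\colon\mathbb{Z}\widetilde Q_n(\widetilde\Lambda)\to\mathcal{P}_n(\Lambda)\big)_{n\in\mathbb{Z}}$ constitutes a map of chain complexes, that is, $\triangledown_{n-1}\circ\partial_n=\partial_n^{\mathcal{P}}\circ\triangledown_n$ for all $n\in\mathbb{Z}$.
   Context: $\mathbb{N}$ includes $0$; $e_1,\dots,e_k$ are the canonical generators of $\mathbb{N}^k$; $\Sigma_n$ is the symmetric group on $\{1,\dots,n\}$. **k-graphs.** A $k$-graph is a countable small category $\Lambda$ with a functor $d\colon\Lambda\to\mathbb{N}^k$ ($\mathbb{N}^k$ a one-object category under addition) with the factorization property: if $d(\lambda)=m+n$ there are unique $\mu,\nu$ with $d(\mu)=m$, $d(\nu)=n$, $\lambda=\mu\nu$. Here $\mu\nu$ is defined iff $s(\mu)=r(\nu)$. $\lambda\in\Lambda$ means $\lambda$ is a morphism; objects are identified with identity morphisms, exactly the morphisms of degree $0$ (vertices). $d_i(\lambda)$ is the $i$-th coordinate of $d(\lambda)$. For $0\le m\le n\le d(\lambda)$, $\lambda(m,n)$ is the unique morphism of degree $n-m$ with $\lambda=\lambda'\lambda(m,n)\lambda''$, $d(\lambda')=m$. A right $\Lambda$-module is a contravariant functor from $\Lambda$ to abelian groups; module maps are natural transformations; $\mathbb{Z}^\Lambda$ is the constant module $\mathbb{Z}$. **Cubical complex.** For a $k$-graph $\Gamma$ with degree $d$, $Q_n(\Gamma)=\{\eta\in\Gamma:\sum_id_i(\eta)=n,\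 d_i(\eta)\in\{0,1\}\ \forall i\}$, and for $\lambda\in Q_n(\Gamma)$ with $d(\lambda)=\sum_{j=1}^ne_{c_j}$, $c_1<\dots<c_n$, $F^0_j(\lambda)=\lambda(0,d(\lambda)-e_{c_j})$, $F^1_j(\lambda)=\lambda(e_{c_j},d(\lambda))$. $\mathbb{Z}\widetilde Q_n(\Gamma)$ is the free abelian group on $Q_n(\Gamma)$ for $n\ge0$, is $\mathbb{Z}$ for $n=-1$, and $0$ for $n<-1$; $\partial_n(\lambda)=\sum_{j=1}^n\sum_{l=0}^1(-1)^{j+l}F^l_j(\lambda)$ for $n\ge1$, and $\partial_0$ sends each vertex to $1$. For a vertex $v$ of $\Lambda$, $\widetilde\Lambda(v)$ is the $k$-graph whose objects are the morphisms of $\Lambda$ with source $v$ and whose morphisms are the composable pairs $(\eta,\mu)$ with $s(\mu)=v$; $(\eta,\mu)$ has source $\mu$, range $\eta\mu$, degree $d(\eta)$. $\mathbb{Z}\widetilde Q_n(\widetilde\Lambda)$ is the right $\Lambda$-module $v\mapsto\mathbb{Z}\widetilde Q_n(\widetilde\Lambda(v))$, with action $(\eta,\mu)\cdot\lambda=(\eta,\mu\lambda)$ for $n\ge0$, and equal to $\mathbb{Z}^\Lambda$ for $n=-1$. **Simplicial complex.** For $n\ge0$, $\mathcal{P}_n(\Lambda)(v)$ is the free abelian group on $\Lambda^{*(n+1)}v$, the set of composable tuples $(\lambda_0,\dots,\lambda_n)$ ($s(\lambda_{i-1})=r(\lambda_i)$) with $s(\lambda_n)=v$; the action is $(\lambda_0,\dots,\lambda_n)\cdot\lambda=(\lambda_0,\dots,\lambda_n\lambda)$.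 $\mathcal{P}_{-1}(\Lambda)=\mathbb{Z}^\Lambda$ and $\mathcal{P}_n(\Lambda)=0$ for $n<-1$. For $n>0$, $\partial_n^{\mathcal{P}}(\lambda_0,\dots,\lambda_n)=(\lambda_1,\dots,\lambda_n)+\sum_{i=1}^n(-1)^i(\lambda_0,\dots,\lambda_{i-1}\lambda_i,\dots,\lambda_n)$, and $\partial_0^{\mathcal{P}}(\lambda)=1$. **The map $\triangledown_*$.** For $n\ge0$ and $(\lambda,\mu)\in Q_n(\widetilde\Lambda(v))$, with $d(\lambda)=\sum_{j=1}^ne_{c_j}$, $c_1<\dots<c_n$, and $\sigma\in\Sigma_n$, write $\lambda=\lambda_1^\sigma\cdots\lambda_n^\sigma$ with $d(\lambda_i^\sigma)=e_{c_{\sigma(i)}}$ (possible in a unique way by the factorization property); then $(\triangledown_n)_v(\lambda,\mu)=\sum_{\sigma\in\Sigma_n}\mathrm{sgn}(\sigma)(\lambda_1^\sigma,\dots,\lambda_n^\sigma,\mu)$, extended linearly. $\triangledown_{-1}=\mathrm{id}_{\mathbb{Z}^\Lambda}$, $\triangledown_n=0$ for $n<-1$. *)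

theory Defs
  imports
    "HOL-Algebra.Free_Abelian_Groups"
    "HOL-Combinatorics.Permutations"
    "HOL-Library.Function_Algebras"
    "HOL-Library.Countable_Set"
begin

section \<open>k-graphs\<close>

text \<open>
  A small category is given by its set of morphisms; an object is identified with its identity
  morphism, so \<open>src\<close> and \<open>rng\<close> take values in \<open>Mor\<close>.  The product \<open>cmp \<mu> \<nu>\<close>
  (written \<open>\<mu>\<nu>\<close> in the literature) is meaningful only when \<open>src \<mu> = rng \<nu>\<close>.
  An element of \<open>\<nat>\<^sup>k\<close> is a function \<^typ>\<open>nat \<Rightarrow> nat\<close> vanishing outside \<open>{1..k}\<close>, with
  pointwise addition, subtraction and zero.
\<close>

record 'a kgraph =
  Mor :: "'a set"
  src :: "'a \<Rightarrow> 'a"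
  rng :: "'a \<Rightarrow> 'a"
  cmp :: "'a \<Rightarrow> 'a \<Rightarrow> 'a"
  deg :: "'a \<Rightarrow> nat \<Rightarrow> nat"

locale small_category =
  fixes \<Lambda> :: "'a kgraph"
  assumes src_in: "\<alpha> \<in> Mor \<Lambda> \<Longrightarrow> src \<Lambda> \<alpha> \<in> Mor \<Lambda>"
    and rng_in: "\<alpha> \<in> Mor \<Lambda> \<Longrightarrow> rng \<Lambda> \<alpha> \<in> Mor \<Lambda>"
    and src_src: "\<alpha> \<in> Mor \<Lambda> \<Longrightarrow> src \<Lambda> (src \<Lambda> \<alpha>) = src \<Lambda> \<alpha>"
    and rng_src: "\<alpha> \<in> Mor \<Lambda> \<Longrightarrow> rng \<Lambda> (src \<Lambda> \<alpha>) = src \<Lambda> \<alpha>"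
    and src_rng: "\<alpha> \<in> Mor \<Lambda> \<Longrightarrow> src \<Lambda> (rng \<Lambda> \<alpha>) = rng \<Lambda> \<alpha>"
    and rng_rng: "\<alpha> \<in> Mor \<Lambda> \<Longrightarrow> rng \<Lambda> (rng \<Lambda> \<alpha>) = rng \<Lambda> \<alpha>"
    and cmp_in: "\<lbrakk>\<mu> \<in> Mor \<Lambda>; \<nu> \<in> Mor \<Lambda>; src \<Lambda> \<mu> = rng \<Lambda> \<nu>\<rbrakk> \<Longrightarrow> cmp \<Lambda> \<mu> \<nu> \<in> Mor \<Lambda>"
    and src_cmp: "\<lbrakk>\<mu> \<in> Mor \<Lambda>; \<nu> \<in> Mor \<Lambda>; src \<Lambda> \<mu> = rng \<Lambda> \<nu>\<rbrakk>
                  \<Longrightarrow> src \<Lambda> (cmp \<Lambda> \<mu> \<nu>) = src \<Lambda> \<nu>"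
    and rng_cmp: "\<lbrakk>\<mu> \<in> Mor \<Lambda>; \<nu> \<in> Mor \<Lambda>; src \<Lambda> \<mu> = rng \<Lambda> \<nu>\<rbrakk>
                  \<Longrightarrow> rng \<Lambda> (cmp \<Lambda> \<mu> \<nu>) = rng \<Lambda> \<mu>"
    and cmp_assoc: "\<lbrakk>\<alpha> \<in> Mor \<Lambda>; \<mu> \<in> Mor \<Lambda>; \<nu> \<in> Mor \<Lambda>; src \<Lambda> \<alpha> = rng \<Lambda> \<mu>; src \<Lambda> \<mu> = rng \<Lambda> \<nu>\<rbrakk>
                  \<Longrightarrow> cmp \<Lambda> (cmp \<Lambda> \<alpha> \<mu>) \<nu> = cmp \<Lambda> \<alpha> (cmp \<Lambda> \<mu> \<nu>)"
    and cmp_rng: "\<alpha> \<in> Mor \<Lambda> \<Longrightarrow> cmp \<Lambda> (rng \<Lambda> \<alpha>) \<alpha> = \<alpha>"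
    and cmp_src: "\<alpha> \<in> Mor \<Lambda> \<Longrightarrow> cmp \<Lambda> \<alpha> (src \<Lambda> \<alpha>) = \<alpha>"

locale k_graph = small_category \<Lambda> for k :: nat and \<Lambda> :: "'a kgraph" +
  assumes countable_Mor: "countable (Mor \<Lambda>)"
    and deg_support: "\<lbrakk>\<alpha> \<in> Mor \<Lambda>; i \<notin> {1..k}\<rbrakk> \<Longrightarrow> deg \<Lambda> \<alpha> i = 0"
    and deg_id: "\<alpha> \<in> Mor \<Lambda> \<Longrightarrow> deg \<Lambda> (src \<Lambda> \<alpha>) = 0"
    and deg_cmp: "\<lbrakk>\<mu> \<in> Mor \<Lambda>; \<nu> \<in> Mor \<Lambda>; src \<Lambda> \<mu> = rng \<Lambda> \<nu>\<rbrakk>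
                  \<Longrightarrow> deg \<Lambda> (cmp \<Lambda> \<mu> \<nu>) = deg \<Lambda> \<mu> + deg \<Lambda> \<nu>"
    and factorization: "\<lbrakk>\<alpha> \<in> Mor \<Lambda>; deg \<Lambda> \<alpha> = m + n\<rbrakk>
          \<Longrightarrow> \<exists>!(\<mu>, \<nu>). \<mu> \<in> Mor \<Lambda> \<and> \<nu> \<in> Mor \<Lambda> \<and> src \<Lambda> \<mu> = rng \<Lambda> \<nu> \<and>
                deg \<Lambda> \<mu> = m \<and> deg \<Lambda> \<nu> = n \<and> cmp \<Lambda> \<mu> \<nu> = \<alpha>"

definition verts :: "'a kgraph \<Rightarrow> 'a set" where
  "verts \<Lambda> = {v \<in> Mor \<Lambda>. deg \<Lambda> v = 0}"

definition unit_deg :: "nat \<Rightarrow> nat \<Rightarrow> nat" where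
  "unit_deg i = (\<lambda>j. if j = i then 1 else 0)"

text \<open>The segment \<open>\<alpha>(m,n)\<close>, for \<open>0 \<le> m \<le> n \<le> d(\<alpha>)\<close>.\<close>

definition segment :: "'a kgraph \<Rightarrow> 'a \<Rightarrow> (nat \<Rightarrow> nat) \<Rightarrow> (nat \<Rightarrow> nat) \<Rightarrow> 'a" where
  "segment \<Lambda> \<alpha> m n = (THE \<tau>. \<tau> \<in> Mor \<Lambda> \<and> deg \<Lambda> \<tau> = n - m \<and>
     (\<exists>\<alpha>'\<in>Mor \<Lambda>. \<exists>\<alpha>''\<in>Mor \<Lambda>. src \<Lambda> \<alpha>' = rng \<Lambda> \<tau> \<and> src \<Lambda> \<tau> = rng \<Lambda> \<alpha>'' \<and>
        deg \<Lambda> \<alpha>' = m \<and> \<alpha> = cmp \<Lambda> \<alpha>' (cmp \<Lambda> \<tau> \<alpha>'')))"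

text \<open>\<open>colour \<Lambda> \<alpha> j\<close> is \<open>c\<^sub>j\<close> where \<open>d(\<alpha>)\<close> is the sum of the generators with indices \<open>c\<^sub>1 < \<dots> < c\<^sub>n\<close>
  (\<open>j\<close> counts from 1).\<close>

definition colour :: "'a kgraph \<Rightarrow> 'a \<Rightarrow> nat \<Rightarrow> nat" where
  "colour \<Lambda> \<alpha> j = sorted_list_of_set {i. deg \<Lambda> \<alpha> i \<noteq> 0} ! (j - 1)"

text \<open>
  The \<open>k\<close>-graph of pairs over a vertex \<open>v\<close>.  Its object \<open>\<mu>\<close> (a morphism of \<open>\<Lambda>\<close> with source \<open>v\<close>)
  is identified with the identity morphism \<open>(r(\<mu>), \<mu>)\<close>.
\<close>

definition tilde :: "'a kgraph \<Rightarrow> 'a \<Rightarrow> ('a \<times> 'a) kgraph" where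
  "tilde \<Lambda> v = \<lparr>
     Mor = {(\<eta>, \<mu>). \<eta> \<in> Mor \<Lambda> \<and> \<mu> \<in> Mor \<Lambda> \<and> src \<Lambda> \<eta> = rng \<Lambda> \<mu> \<and> src \<Lambda> \<mu> = v},
     src = (\<lambda>(\<eta>, \<mu>). (rng \<Lambda> \<mu>, \<mu>)),
     rng = (\<lambda>(\<eta>, \<mu>). (rng \<Lambda> \<eta>, cmp \<Lambda> \<eta> \<mu>)),
     cmp = (\<lambda>(\<eta>, \<mu>) (\<eta>', \<mu>'). (cmp \<Lambda> \<eta> \<eta>', \<mu>')),
     deg = (\<lambda>(\<eta>, \<mu>). deg \<Lambda> \<eta>)\<rparr>"


section \<open>Right modules, module maps and chain complexes\<close>

text \<open>\<open>act M \<alpha> x\<close> is \<open>x\<cdot>\<alpha>\<close>, for \<open>x\<close> in the group at \<open>r(\<alpha>)\<close>, with value in the group at \<open>s(\<alpha>)\<close>.\<close>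

record ('a, 'm) rmodule =
  grp :: "'a \<Rightarrow> 'm monoid"
  act :: "'a \<Rightarrow> 'm \<Rightarrow> 'm"

definition right_module :: "'a kgraph \<Rightarrow> ('a, 'm) rmodule \<Rightarrow> bool" where
  "right_module \<Lambda> M \<longleftrightarrow>
     (\<forall>v\<in>verts \<Lambda>. comm_group (grp M v)) \<and>
     (\<forall>\<alpha>\<in>Mor \<Lambda>. act M \<alpha> \<in> hom (grp M (rng \<Lambda> \<alpha>)) (grp M (src \<Lambda> \<alpha>))) \<and>
     (\<forall>v\<in>verts \<Lambda>. \<forall>x\<in>carrier (grp M v). act M v x = x) \<and>
     (\<forall>\<alpha>\<in>Mor \<Lambda>. \<forall>\<mu>\<in>Mor \<Lambda>. src \<Lambda> \<alpha> = rng \<Lambda> \<mu> \<longrightarrow>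
        (\<forall>x\<in>carrier (grp M (rng \<Lambda> \<alpha>)). act M (cmp \<Lambda> \<alpha> \<mu>) x = act M \<mu> (act M \<alpha> x)))"

definition module_map ::
  "'a kgraph \<Rightarrow> ('a, 'm) rmodule \<Rightarrow> ('a, 'n) rmodule \<Rightarrow> ('a \<Rightarrow> 'm \<Rightarrow> 'n) \<Rightarrow> bool" where
  "module_map \<Lambda> M N f \<longleftrightarrow>
     (\<forall>v\<in>verts \<Lambda>. f v \<in> hom (grp M v) (grp N v)) \<and>
     (\<forall>\<alpha>\<in>Mor \<Lambda>. \<forall>x\<in>carrier (grp M (rng \<Lambda> \<alpha>)).
        f (src \<Lambda> \<alpha>) (act M \<alpha> x) = act N \<alpha> (f (rng \<Lambda> \<alpha>) x))"

definition chain_complex ::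
  "'a kgraph \<Rightarrow> (int \<Rightarrow> ('a, 'm) rmodule) \<Rightarrow> (int \<Rightarrow> 'a \<Rightarrow> 'm \<Rightarrow> 'm) \<Rightarrow> bool" where
  "chain_complex \<Lambda> C bd \<longleftrightarrow>
     (\<forall>n. right_module \<Lambda> (C n)) \<and>
     (\<forall>n. module_map \<Lambda> (C n) (C (n - 1)) (bd n)) \<and>
     (\<forall>n. \<forall>v\<in>verts \<Lambda>. \<forall>x\<in>carrier (grp (C n) v).
        bd (n - 1) v (bd n v x) = \<one>\<^bsub>grp (C (n - 2)) v\<^esub>)"

definition chain_map ::
  "'a kgraph \<Rightarrow> (int \<Rightarrow> ('a, 'm) rmodule) \<Rightarrow> (int \<Rightarrow> 'a \<Rightarrow> 'm \<Rightarrow> 'm) \<Rightarrow>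
   (int \<Rightarrow> ('a, 'n) rmodule) \<Rightarrow> (int \<Rightarrow> 'a \<Rightarrow> 'n \<Rightarrow> 'n) \<Rightarrow> (int \<Rightarrow> 'a \<Rightarrow> 'm \<Rightarrow> 'n) \<Rightarrow> bool" where
  "chain_map \<Lambda> C bd D bd' f \<longleftrightarrow>
     chain_complex \<Lambda> C bd \<and> chain_complex \<Lambda> D bd' \<and>
     (\<forall>n. module_map \<Lambda> (C n) (D n) (f n)) \<and>
     (\<forall>n. \<forall>v\<in>verts \<Lambda>. \<forall>x\<in>carrier (grp (C n) v). f (n - 1) v (bd n v x) = bd' n v (f n v x))"


section \<open>The cubical complex\<close>

text \<open>
  All chain groups are free abelian groups on sets of type \<open>_ option\<close>.  In degrees \<open>n \<ge> 0\<close> the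
  generators are \<open>Some \<eta>\<close>; in degree \<open>-1\<close> the group \<open>\<int>\<close> is represented as the free abelian group
  on the single generator \<open>None\<close>, which stands for \<open>1 \<in> \<int>\<close>; in degrees \<open>n < -1\<close> there are no
  generators.  In \<open>cubes\<close> the coordinate sum runs over the (finite) support of the degree.
\<close>

definition cubes :: "'a kgraph \<Rightarrow> nat \<Rightarrow> 'a set" where
  "cubes \<Gamma> n = {\<eta> \<in> Mor \<Gamma>. (\<forall>i. deg \<Gamma> \<eta> i \<in> {0, 1}) \<and> (\<Sum>i | deg \<Gamma> \<eta> i \<noteq> 0. deg \<Gamma> \<eta> i) = n}"

definition cube_face :: "'a kgraph \<Rightarrow> nat \<Rightarrow> nat \<Rightarrow> 'a \<Rightarrow> 'a" where
  "cube_face \<Gamma> l j \<alpha> =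
     (if l = 0 then segment \<Gamma> \<alpha> 0 (deg \<Gamma> \<alpha> - unit_deg (colour \<Gamma> \<alpha> j))
      else segment \<Gamma> \<alpha> (unit_deg (colour \<Gamma> \<alpha> j)) (deg \<Gamma> \<alpha>))"

definition cube_gens :: "'a kgraph \<Rightarrow> int \<Rightarrow> 'a option set" where
  "cube_gens \<Gamma> n = (if n \<ge> 0 then Some ` cubes \<Gamma> (nat n) else if n = -1 then {None} else {})"

definition cube_boundary :: "'a kgraph \<Rightarrow> int \<Rightarrow> ('a option \<Rightarrow>\<^sub>0 int) \<Rightarrow> ('a option \<Rightarrow>\<^sub>0 int)" where
  "cube_boundary \<Gamma> n = frag_extend (\<lambda>g. case g of
     None \<Rightarrow> 0
   | Some \<alpha> \<Rightarrow>
       if n \<ge> 1 then (\<Sum>j = 1..nat n. \<Sum>l = 0..1.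
          frag_cmul ((-1) ^ (j + l)) (frag_of (Some (cube_face \<Gamma> l j \<alpha>))))
       else if n = 0 then frag_of None
       else 0)"

text \<open>The action fixes \<open>None\<close>: in degree \<open>-1\<close> the module is the constant one.\<close>

definition cubical_module ::
  "'a kgraph \<Rightarrow> int \<Rightarrow> ('a, ('a \<times> 'a) option \<Rightarrow>\<^sub>0 int) rmodule" where
  "cubical_module \<Lambda> n = \<lparr>
     grp = (\<lambda>v. free_Abelian_group (cube_gens (tilde \<Lambda> v) n)),
     act = (\<lambda>\<alpha>. frag_extend (\<lambda>g. frag_of (map_option (\<lambda>(\<eta>, \<mu>). (\<eta>, cmp \<Lambda> \<mu> \<alpha>)) g)))\<rparr>"

definition cubical_boundary ::
  "'a kgraph \<Rightarrow> int \<Rightarrow> 'a \<Rightarrow> (('a \<times> 'a) option \<Rightarrow>\<^sub>0 int) \<Rightarrow> (('a \<times> 'a) option \<Rightarrow>\<^sub>0 int)" where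
  "cubical_boundary \<Lambda> n v = cube_boundary (tilde \<Lambda> v) n"


section \<open>The simplicial complex\<close>

text \<open>A tuple \<open>(\<alpha>\<^sub>0, \<dots>, \<alpha>\<^sub>n)\<close> is a list of length \<open>n + 1\<close>.\<close>

definition composable :: "'a kgraph \<Rightarrow> 'a list \<Rightarrow> bool" where
  "composable \<Lambda> xs \<longleftrightarrow> set xs \<subseteq> Mor \<Lambda> \<and>
     (\<forall>i. Suc i < length xs \<longrightarrow> src \<Lambda> (xs ! i) = rng \<Lambda> (xs ! Suc i))"

definition simp_gens :: "'a kgraph \<Rightarrow> 'a \<Rightarrow> int \<Rightarrow> 'a list option set" where
  "simp_gens \<Lambda> v n =
     (if n \<ge> 0 then Some ` {xs. length xs = nat n + 1 \<and> composable \<Lambda> xs \<and> src \<Lambda> (last xs) = v}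
      else if n = -1 then {None} else {})"

definition simplicial_module ::
  "'a kgraph \<Rightarrow> int \<Rightarrow> ('a, 'a list option \<Rightarrow>\<^sub>0 int) rmodule" where
  "simplicial_module \<Lambda> n = \<lparr>
     grp = (\<lambda>v. free_Abelian_group (simp_gens \<Lambda> v n)),
     act = (\<lambda>\<alpha>. frag_extend (\<lambda>g.
              frag_of (map_option (\<lambda>xs. butlast xs @ [cmp \<Lambda> (last xs) \<alpha>]) g)))\<rparr>"

text \<open>\<open>(\<alpha>\<^sub>0, \<dots>, \<alpha>\<^bsub>i-1\<^esub>\<alpha>\<^sub>i, \<dots>, \<alpha>\<^sub>n)\<close>\<close>

definition merge_at :: "'a kgraph \<Rightarrow> nat \<Rightarrow> 'a list \<Rightarrow> 'a list" where
  "merge_at \<Lambda> i xs = take (i - 1) xs @ [cmp \<Lambda> (xs ! (i - 1)) (xs ! i)] @ drop (i + 1) xs"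

definition simplicial_boundary ::
  "'a kgraph \<Rightarrow> int \<Rightarrow> 'a \<Rightarrow> ('a list option \<Rightarrow>\<^sub>0 int) \<Rightarrow> ('a list option \<Rightarrow>\<^sub>0 int)" where
  "simplicial_boundary \<Lambda> n v = frag_extend (\<lambda>g. case g of
     None \<Rightarrow> 0
   | Some xs \<Rightarrow>
       if n \<ge> 1 then frag_of (Some (tl xs)) +
          (\<Sum>i = 1..nat n. frag_cmul ((-1) ^ i) (frag_of (Some (merge_at \<Lambda> i xs))))
       else if n = 0 then frag_of None
       else 0)"


section \<open>The comparison map\<close>

text \<open>
  The list \<open>[\<alpha>\<^sub>1\<^sup>\<sigma>, \<dots>, \<alpha>\<^sub>n\<^sup>\<sigma>]\<close>.  Multiplying by the identity \<open>s(\<alpha>)\<close> at the right end covers the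
  case \<open>n = 0\<close>, where the list is empty and \<open>\<alpha>\<close> is a vertex.
\<close>

definition edge_factors :: "'a kgraph \<Rightarrow> nat \<Rightarrow> 'a \<Rightarrow> (nat \<Rightarrow> nat) \<Rightarrow> 'a list" where
  "edge_factors \<Lambda> n \<alpha> \<sigma> = (THE xs. length xs = n \<and> composable \<Lambda> (xs @ [src \<Lambda> \<alpha>]) \<and>
     (\<forall>i\<in>{1..n}. deg \<Lambda> (xs ! (i - 1)) = unit_deg (colour \<Lambda> \<alpha> (\<sigma> i))) \<and>
     foldr (cmp \<Lambda>) xs (src \<Lambda> \<alpha>) = \<alpha>)"

definition comparison ::
  "'a kgraph \<Rightarrow> int \<Rightarrow> 'a \<Rightarrow> (('a \<times> 'a) option \<Rightarrow>\<^sub>0 int) \<Rightarrow> ('a list option \<Rightarrow>\<^sub>0 int)" where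
  "comparison \<Lambda> n v = frag_extend (\<lambda>g. case g of
     None \<Rightarrow> if n = -1 then frag_of None else 0
   | Some (\<alpha>, \<mu>) \<Rightarrow>
       if n \<ge> 0 then (\<Sum>\<sigma> | \<sigma> permutes {1..nat n}.
          frag_cmul (sign \<sigma>) (frag_of (Some (edge_factors \<Lambda> (nat n) \<alpha> \<sigma> @ [\<mu>]))))
       else 0)"

end

theory Submission
  imports Defs "HOL-Combinatorics.Multiset_Permutations"
begin

text \<open>
  Both complexes consist of free abelian groups, with module actions and differentials given on
  generators, so every identity is checked on a generator \<open>(\<alpha>, \<mu>)\<close>, where \<open>\<alpha>\<close> is an \<open>n\<close>-cube.

  The heart of the matter is that the comparison map \<open>\<triangledown>\<close> subdivides a cube into simplices, one for each
  order in which the \<open>n\<close> directions can be traversed.  It is convenient to index these simplices not by a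
  permutation \<open>\<sigma>\<close> of \<open>{1..n}\<close> but by the list \<open>cs\<close> of colours in the order in which they are
  traversed; the sign of \<open>\<sigma>\<close> is then the parity of the number of inversions of \<open>cs\<close>
  (\<open>comparison_gen_cube\<close>).  Lists make the recursive structure visible.  The simplicial boundary of
  the simplex \<open>(\<lambda>\<^sub>1, \<dots>, \<lambda>\<^sub>n, \<mu>)\<close> of \<open>cs\<close> has three kinds of faces.

  \<^item> The faces composing two neighbouring edges cancel.  By the factorization property
    such a face is determined by the cube and the list of degrees of its entries, hence does not
    depend on the order of the two neighbouring colours, while exchanging them changes the sign (\<open>inner_faces_cancel\<close>).
  \<^item> Deleting the first edge, of colour \<open>c\<close> say, leaves a simplex of the cube face \<open>F\<^sup>1\<close> in direction
    \<open>c\<close>; the sign changes by the parity of the number of colours below \<open>c\<close>, which is the sign of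
    that face in the cubical boundary (\<open>first_faces_sum\<close>).
  \<^item> Absorbing the last edge into \<open>\<mu>\<close> gives in the same way the simplices of the faces \<open>F\<^sup>0\<close>
    (\<open>last_faces_sum\<close>).

  A chain map needs chain complexes on both sides.  For the simplicial side this is the usual
  cancellation derived from the simplicial identities, and the cubical side inherits \<open>\<partial> \<circ> \<partial> = 0\<close> from
  it: \<open>\<triangledown>\<close> is injective, because the simplex with increasing colours determines the cube, and
  \<open>\<triangledown> \<circ> \<partial> \<circ> \<partial> = \<partial> \<circ> \<partial> \<circ> \<triangledown> = 0\<close>
  (\<open>comparison_injective\<close>, \<open>cubical_boundary_boundary\<close>).
\<close>

section \<open>Modules of free abelian groups\<close>

lemma frag_extend_frag_extend:
  "frag_extend f (frag_extend g c) = frag_extend (\<lambda>x. frag_extend f (g x)) c"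
proof -
  have "Poly_Mapping.keys c \<subseteq> UNIV" by simp
  then show ?thesis
    by (induction c rule: frag_induction) (auto simp: frag_extend_diff)
qed

lemma keys_frag_extend_subset:
  assumes "Poly_Mapping.keys c \<subseteq> S" "\<And>x. x \<in> S \<Longrightarrow> Poly_Mapping.keys (f x) \<subseteq> T"
  shows "Poly_Mapping.keys (frag_extend f c) \<subseteq> T"
  using keys_frag_extend[of f c] assms by blast

lemma keys_frag_sum_subset:
  assumes "\<And>i. i \<in> I \<Longrightarrow> Poly_Mapping.keys (f i :: 'b \<Rightarrow>\<^sub>0 int) \<subseteq> S"
  shows "Poly_Mapping.keys (sum f I) \<subseteq> S"
  using sum_closed_free_Abelian_group[of I f S] assms by simp

lemma keys_signed_generator_subset:
  "g \<in> S \<Longrightarrow> Poly_Mapping.keys (frag_cmul c (frag_of g)) \<subseteq> S"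
  by auto

lemma frag_extend_signed_sum:
  assumes "finite I"
  shows "frag_extend f (\<Sum>i\<in>I. frag_cmul (s i) (x i)) = (\<Sum>i\<in>I. frag_cmul (s i) (frag_extend f (x i)))"
  using assms by (simp add: frag_extend_sum frag_extend_cmul)

lemma frag_extend_in_hom:
  assumes "\<And>g. g \<in> G \<Longrightarrow> Poly_Mapping.keys (f g) \<subseteq> H"
  shows "frag_extend f \<in> hom (free_Abelian_group G) (free_Abelian_group H)"
proof (intro homI)
  fix x assume "x \<in> carrier (free_Abelian_group G)"
  then show "frag_extend f x \<in> carrier (free_Abelian_group H)"
    using keys_frag_extend_subset[OF _ assms] by (simp only: carrier_free_Abelian_group_iff)
qed (simp add: frag_extend_add)

lemma frag_cmul_diff_right: "frag_cmul c (a - b) = frag_cmul c a - frag_cmul c b"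
  by (rule poly_mapping_eqI) (simp add: lookup_minus right_diff_distrib)

lemma frag_eq_minus_self_iff: "(x :: 'c \<Rightarrow>\<^sub>0 int) = - x \<longleftrightarrow> x = 0"
proof
  assume x: "x = - x"
  show "x = 0"
  proof (rule poly_mapping_eqI)
    fix k
    have "Poly_Mapping.lookup x k = Poly_Mapping.lookup (- x) k" by (subst x) (rule refl)
    then show "Poly_Mapping.lookup x k = Poly_Mapping.lookup 0 k" by simp
  qed
qed simp

lemma keys_frag_cmul_diff_subset:
  "g \<in> S \<Longrightarrow> h \<in> S \<Longrightarrow> Poly_Mapping.keys (frag_cmul c (frag_of g - frag_of h)) \<subseteq> S"
  using keys_cmul[of c "frag_of g - frag_of h"] keys_diff[of "frag_of g" "frag_of h"] by auto

text \<open>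
  All modules of the two complexes arise from a contravariant set-valued functor, the sets of
  generators, by passing to free abelian groups; this reduces the module axioms to the functor axioms.
\<close>

lemma free_right_module:
  assumes closed: "\<And>\<alpha> g. \<alpha> \<in> Mor \<Lambda> \<Longrightarrow> g \<in> G (rng \<Lambda> \<alpha>) \<Longrightarrow> a \<alpha> g \<in> G (src \<Lambda> \<alpha>)"
    and unit: "\<And>v g. v \<in> verts \<Lambda> \<Longrightarrow> g \<in> G v \<Longrightarrow> a v g = g"
    and cmp: "\<And>\<alpha> \<mu> g. \<alpha> \<in> Mor \<Lambda> \<Longrightarrow> \<mu> \<in> Mor \<Lambda> \<Longrightarrow> src \<Lambda> \<alpha> = rng \<Lambda> \<mu> \<Longrightarrow> g \<in> G (rng \<Lambda> \<alpha>) \<Longrightarrow>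
                a (cmp \<Lambda> \<alpha> \<mu>) g = a \<mu> (a \<alpha> g)"
  shows "right_module \<Lambda> \<lparr>grp = \<lambda>v. free_Abelian_group (G v),
                            act = \<lambda>\<alpha>. frag_extend (\<lambda>g. frag_of (a \<alpha> g))\<rparr>"
  unfolding right_module_def rmodule.simps
proof (intro conjI ballI impI)
  fix \<alpha> assume "\<alpha> \<in> Mor \<Lambda>"
  then show "frag_extend (\<lambda>g. frag_of (a \<alpha> g))
      \<in> hom (free_Abelian_group (G (rng \<Lambda> \<alpha>))) (free_Abelian_group (G (src \<Lambda> \<alpha>)))"
    by (intro frag_extend_in_hom) (simp add: closed)
next
  fix v x assume v: "v \<in> verts \<Lambda>" and x: "x \<in> carrier (free_Abelian_group (G v))"
  have "frag_extend (\<lambda>g. frag_of (a v g)) x = frag_extend frag_of x"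
    using x unit[OF v] by (intro frag_extend_eq) auto
  then show "frag_extend (\<lambda>g. frag_of (a v g)) x = x"
    using frag_expansion[of x] by simp
next
  fix \<alpha> \<mu> x
  assume *: "\<alpha> \<in> Mor \<Lambda>" "\<mu> \<in> Mor \<Lambda>" "src \<Lambda> \<alpha> = rng \<Lambda> \<mu>"
    and x: "x \<in> carrier (free_Abelian_group (G (rng \<Lambda> \<alpha>)))"
  then show "frag_extend (\<lambda>g. frag_of (a (cmp \<Lambda> \<alpha> \<mu>) g)) x =
         frag_extend (\<lambda>g. frag_of (a \<mu> g)) (frag_extend (\<lambda>g. frag_of (a \<alpha> g)) x)"
    unfolding frag_extend_frag_extend
    by (intro frag_extend_eq) (auto simp: cmp[OF *])
qed (rule abelian_free_Abelian_group)

lemma free_module_map: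
  assumes closed: "\<And>v g. v \<in> verts \<Lambda> \<Longrightarrow> g \<in> G v \<Longrightarrow> Poly_Mapping.keys (\<phi> v g) \<subseteq> H v"
    and natural: "\<And>\<alpha> g. \<alpha> \<in> Mor \<Lambda> \<Longrightarrow> g \<in> G (rng \<Lambda> \<alpha>) \<Longrightarrow>
           \<phi> (src \<Lambda> \<alpha>) (a \<alpha> g) = frag_extend (\<lambda>h. frag_of (b \<alpha> h)) (\<phi> (rng \<Lambda> \<alpha>) g)"
  shows "module_map \<Lambda>
     \<lparr>grp = \<lambda>v. free_Abelian_group (G v), act = \<lambda>\<alpha>. frag_extend (\<lambda>g. frag_of (a \<alpha> g))\<rparr>
     \<lparr>grp = \<lambda>v. free_Abelian_group (H v), act = \<lambda>\<alpha>. frag_extend (\<lambda>h. frag_of (b \<alpha> h))\<rparr>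
     (\<lambda>v. frag_extend (\<phi> v))"
  unfolding module_map_def rmodule.simps
proof (intro conjI ballI)
  fix v assume v: "v \<in> verts \<Lambda>"
  show "frag_extend (\<phi> v) \<in> hom (free_Abelian_group (G v)) (free_Abelian_group (H v))"
    by (intro frag_extend_in_hom closed v)
next
  fix \<alpha> x assume "\<alpha> \<in> Mor \<Lambda>" "x \<in> carrier (free_Abelian_group (G (rng \<Lambda> \<alpha>)))"
  then show "frag_extend (\<phi> (src \<Lambda> \<alpha>)) (frag_extend (\<lambda>g. frag_of (a \<alpha> g)) x)
       = frag_extend (\<lambda>h. frag_of (b \<alpha> h)) (frag_extend (\<phi> (rng \<Lambda> \<alpha>)) x)"
    unfolding frag_extend_frag_extend
    by (intro frag_extend_eq) (auto simp: natural)
qed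

lemma frag_extend_comp_eq_on_generators:
  assumes "Poly_Mapping.keys x \<subseteq> G"
    and "\<And>g. g \<in> G \<Longrightarrow> frag_extend f (\<phi> g) = frag_extend f' (\<phi>' g)"
  shows "frag_extend f (frag_extend \<phi> x) = frag_extend f' (frag_extend \<phi>' x)"
  unfolding frag_extend_frag_extend using assms by (intro frag_extend_eq) auto

section \<open>The simplicial complex\<close>

text \<open>
  The terms with \<open>i < j\<close> and those with \<open>j \<le> i\<close> are matched by \<open>(j, i) \<mapsto> (i, j - 1)\<close>, which
  preserves the term and flips its sign.  Here \<open>f i j\<close> stands for the face \<open>d\<^sub>i d\<^sub>j\<close>.
\<close>

lemma presimplicial_double_sum_eq_0:
  fixes f :: "nat \<Rightarrow> nat \<Rightarrow> 'c \<Rightarrow>\<^sub>0 int"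
  assumes "\<And>i j. i < j \<Longrightarrow> j \<le> Suc n \<Longrightarrow> f i j = f (j - 1) i"
  shows "(\<Sum>j\<le>Suc n. \<Sum>i\<le>n. frag_cmul ((-1) ^ (i + j)) (f i j)) = 0"
proof -
  let ?g = "\<lambda>(j, i). frag_cmul ((-1) ^ (i + j)) (f i j)"
  let ?A = "{(j, i). j \<le> Suc n \<and> i < j}" and ?B = "{(j, i). i \<le> n \<and> j \<le> i}"
  have split: "{..Suc n} \<times> {..n} = ?A \<union> ?B" by auto
  have "finite ({..Suc n} \<times> {..n})" by simp
  then have fin: "finite ?A" "finite ?B" unfolding split by simp_all
  have "sum ?g ?A = sum (\<lambda>p. - ?g p) ?B"
  proof (rule sum.reindex_bij_witness[where i = "\<lambda>(j, i). (Suc i, j)" and j = "\<lambda>(j, i). (i, j - 1)"],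
         goal_cases)
    case (5 p)
    obtain j i where p: "p = (Suc j, i)" "i \<le> j" "j \<le> n"
      using 5 by (cases p; case_tac a) auto
    have "f i (Suc j) = f j i" using assms[of i "Suc j"] p by simp
    then show ?case using p by (simp add: add.commute)
  qed auto
  then have "sum ?g ?A + sum ?g ?B = 0"
    by (simp only: sum_negf ab_group_add_class.ab_left_minus)
  moreover have "sum ?g ({..Suc n} \<times> {..n}) = sum ?g ?A + sum ?g ?B"
    unfolding split by (rule sum.union_disjoint[OF fin]) auto
  ultimately have "sum ?g ({..Suc n} \<times> {..n}) = 0" by simp
  then show ?thesis by (simp add: sum.cartesian_product)
qed

definition simp_face :: "'a kgraph \<Rightarrow> nat \<Rightarrow> 'a list \<Rightarrow> 'a list" where
  "simp_face \<Lambda> i xs = (if i = 0 then tl xs else merge_at \<Lambda> i xs)"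

lemma simplicial_boundary_eq_faces:
  assumes "n \<ge> 1"
  shows "frag_of (Some (tl xs)) +
          (\<Sum>i = 1..n. frag_cmul ((-1) ^ i) (frag_of (Some (merge_at \<Lambda> i xs))))
       = (\<Sum>i\<le>n. frag_cmul ((-1) ^ i) (frag_of (Some (simp_face \<Lambda> i xs))))"
proof -
  have "{..n} = insert 0 {1..n}" by auto
  then show ?thesis by (simp add: simp_face_def)
qed

lemma composable_simps [simp]:
  "composable \<Lambda> []"
  "composable \<Lambda> [x] \<longleftrightarrow> x \<in> Mor \<Lambda>"
  "composable \<Lambda> (x # y # zs) \<longleftrightarrow> x \<in> Mor \<Lambda> \<and> src \<Lambda> x = rng \<Lambda> y \<and> composable \<Lambda> (y # zs)"
  by (auto simp: composable_def nth_Cons split: nat.splits)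

lemma composable_ConsD: "composable \<Lambda> (x # xs) \<Longrightarrow> x \<in> Mor \<Lambda> \<and> composable \<Lambda> xs"
  by (cases xs) auto

text \<open>
  For positions inside the tuple these two equations determine \<open>merge_at\<close> by recursion, so that the facts about faces
  below follow by induction on the position; only position 1 involves the category.
\<close>

lemma merge_at_simps [simp]:
  "merge_at \<Lambda> (Suc 0) (x # y # zs) = cmp \<Lambda> x y # zs"
  "merge_at \<Lambda> (Suc (Suc i)) (x # xs) = x # merge_at \<Lambda> (Suc i) xs"
  by (auto simp: merge_at_def)

lemma merge_at_append:
  "merge_at \<Lambda> (Suc (length xs)) (xs @ x # y # ys) = xs @ cmp \<Lambda> x y # ys"
  by (simp add: merge_at_def nth_append)

lemma merge_at_append_left:
  "0 < i \<Longrightarrow> i < length xs \<Longrightarrow> merge_at \<Lambda> i (xs @ ys) = merge_at \<Lambda> i xs @ ys"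
  using less_imp_diff_less[of i "length xs" 1] by (simp add: merge_at_def nth_append)

context small_category
begin

text \<open>
  The range of the first entry has to be carried along: it is what makes the entry preceding the
  merged part still composable in the induction.
\<close>

lemma composable_merge_at:
  assumes "composable \<Lambda> xs" "0 < i" "i < length xs"
  shows "composable \<Lambda> (merge_at \<Lambda> i xs) \<and> length (merge_at \<Lambda> i xs) = length xs - 1 \<and>
         rng \<Lambda> (hd (merge_at \<Lambda> i xs)) = rng \<Lambda> (hd xs) \<and>
         src \<Lambda> (last (merge_at \<Lambda> i xs)) = src \<Lambda> (last xs)"
  using assms
proof (induction i arbitrary: xs)
  case (Suc i)
  obtain x y zs where xs: "xs = x # y # zs"
    using Suc.prems by (cases xs rule: remdups_adj.cases) auto
  show ?case
  proof (cases i)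
    case 0
    then show ?thesis using Suc.prems xs by (cases zs) (auto simp: src_cmp rng_cmp cmp_in)
  next
    case (Suc m)
    have IH: "composable \<Lambda> (merge_at \<Lambda> i (y # zs)) \<and> length (merge_at \<Lambda> i (y # zs)) = length zs \<and>
         rng \<Lambda> (hd (merge_at \<Lambda> i (y # zs))) = rng \<Lambda> y \<and>
         src \<Lambda> (last (merge_at \<Lambda> i (y # zs))) = src \<Lambda> (last (y # zs))"
      using Suc.IH[of "y # zs"] Suc.prems xs Suc by auto
    then show ?thesis using Suc.prems xs Suc
      by (cases "merge_at \<Lambda> i (y # zs)") auto
  qed
qed simp

lemma composable_tl: "composable \<Lambda> xs \<Longrightarrow> composable \<Lambda> (tl xs)"
  by (cases xs rule: remdups_adj.cases) auto

lemma simp_face_closed: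
  assumes "composable \<Lambda> xs" "length xs = Suc (Suc n)" "i \<le> Suc n"
  shows "composable \<Lambda> (simp_face \<Lambda> i xs)" "length (simp_face \<Lambda> i xs) = Suc n"
    "src \<Lambda> (last (simp_face \<Lambda> i xs)) = src \<Lambda> (last xs)"
  using assms composable_merge_at[of xs i] composable_tl[of xs] last_tl[of xs]
  by (auto simp: simp_face_def simp flip: length_0_conv)

text \<open>
  For \<open>j = i + 1\<close> this is associativity; otherwise the two merges do not interact.
\<close>

lemma merge_at_merge_at:
  assumes "composable \<Lambda> xs" "0 < i" "i < j" "j < length xs"
  shows "merge_at \<Lambda> i (merge_at \<Lambda> j xs) = merge_at \<Lambda> (j - 1) (merge_at \<Lambda> i xs)"
  using assms
proof (induction i arbitrary: xs j)
  case (Suc i)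
  obtain x y zs where xs: "xs = x # y # zs"
    using Suc.prems by (cases xs rule: remdups_adj.cases) auto
  obtain m where j: "j = Suc (Suc m)" using Suc.prems that[of "j - 2"] by simp
  show ?case
  proof (cases i)
    case 0
    obtain z ws where zs: "zs = z # ws" using Suc.prems xs j by (cases zs) auto
    show ?thesis using 0 Suc.prems xs j zs by (cases m) (auto simp: cmp_assoc dest: composable_ConsD)
  next
    case i: (Suc l)
    then obtain m' where m: "m = Suc m'" using Suc.prems j by (cases m) auto
    show ?thesis using Suc.IH[of "y # zs" "Suc m"] Suc.prems xs j i m by simp
  qed
qed simp

lemma simp_face_simp_face:
  assumes "composable \<Lambda> xs" "length xs = Suc (Suc (Suc n))" "i < j" "j \<le> Suc (Suc n)"
  shows "simp_face \<Lambda> i (simp_face \<Lambda> j xs) = simp_face \<Lambda> (j - 1) (simp_face \<Lambda> i xs)"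
proof (cases "i = 0")
  case True
  obtain x y zs where xs: "xs = x # y # zs"
    using assms by (cases xs rule: remdups_adj.cases) auto
  obtain m where j: "j = Suc m" using assms by (cases j) auto
  show ?thesis using True assms xs j by (cases m) (auto simp: simp_face_def)
qed (use assms merge_at_merge_at[of xs i j] in \<open>auto simp: simp_face_def\<close>)

text \<open>
  The action changes only the last entry, so the only case with content is the merge involving that
  entry, where the claim is associativity.
\<close>

lemma merge_at_act_last:
  assumes "composable \<Lambda> xs" "0 < i" "i < length xs" "\<alpha> \<in> Mor \<Lambda>" "src \<Lambda> (last xs) = rng \<Lambda> \<alpha>"
  shows "merge_at \<Lambda> i (butlast xs @ [cmp \<Lambda> (last xs) \<alpha>]) =
         butlast (merge_at \<Lambda> i xs) @ [cmp \<Lambda> (last (merge_at \<Lambda> i xs)) \<alpha>]"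
  using assms
proof (induction i arbitrary: xs)
  case (Suc i)
  obtain x y zs where xs: "xs = x # y # zs"
    using Suc.prems by (cases xs rule: remdups_adj.cases) auto
  show ?case
  proof (cases i)
    case 0
    then show ?thesis using Suc.prems xs by (cases zs) (auto simp: cmp_assoc)
  next
    case i: (Suc l)
    have "merge_at \<Lambda> i (y # zs) \<noteq> []"
      using composable_merge_at[of "y # zs" i] Suc.prems xs i by (auto simp flip: length_0_conv)
    then show ?thesis using Suc.IH[of "y # zs"] Suc.prems xs i by auto
  qed
qed simp

lemma simp_face_act_last:
  assumes "composable \<Lambda> xs" "length xs = Suc (Suc n)" "i \<le> Suc n" "\<alpha> \<in> Mor \<Lambda>"
    "src \<Lambda> (last xs) = rng \<Lambda> \<alpha>"
  shows "simp_face \<Lambda> i (butlast xs @ [cmp \<Lambda> (last xs) \<alpha>]) =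
         butlast (simp_face \<Lambda> i xs) @ [cmp \<Lambda> (last (simp_face \<Lambda> i xs)) \<alpha>]"
proof (cases "i = 0")
  case True
  show ?thesis using True assms(2)
    by (cases xs rule: remdups_adj.cases) (auto simp: simp_face_def)
qed (use assms merge_at_act_last[of xs i] in \<open>auto simp: simp_face_def\<close>)

lemma composable_act_last:
  assumes "composable \<Lambda> xs" "xs \<noteq> []" "\<alpha> \<in> Mor \<Lambda>" "src \<Lambda> (last xs) = rng \<Lambda> \<alpha>"
  shows "composable \<Lambda> (butlast xs @ [cmp \<Lambda> (last xs) \<alpha>])"
  using assms
proof (induction xs rule: induct_list012)
  case (3 x y zs)
  then show ?case by (cases zs) (auto simp: rng_cmp cmp_in)
qed (auto simp: cmp_in)

lemma last_in_Mor: "composable \<Lambda> xs \<Longrightarrow> xs \<noteq> [] \<Longrightarrow> last xs \<in> Mor \<Lambda>"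
  by (auto simp: composable_def)

definition simplicial_boundary_gen :: "int \<Rightarrow> 'a list option \<Rightarrow> 'a list option \<Rightarrow>\<^sub>0 int" where
  "simplicial_boundary_gen n g = (case g of
     None \<Rightarrow> 0
   | Some xs \<Rightarrow>
       if n \<ge> 1 then frag_of (Some (tl xs)) +
          (\<Sum>i = 1..nat n. frag_cmul ((-1) ^ i) (frag_of (Some (merge_at \<Lambda> i xs))))
       else if n = 0 then frag_of None
       else 0)"

lemma simplicial_boundary_eq: "simplicial_boundary \<Lambda> n = (\<lambda>v. frag_extend (simplicial_boundary_gen n))"
  unfolding simplicial_boundary_def simplicial_boundary_gen_def by (rule refl)

lemma simplicial_boundary_gen_None [simp]: "simplicial_boundary_gen n None = 0"
  by (simp add: simplicial_boundary_gen_def)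

lemma simplicial_boundary_gen_0 [simp]: "simplicial_boundary_gen 0 (Some xs) = frag_of None"
  by (simp add: simplicial_boundary_gen_def)

lemma simplicial_boundary_gen_Suc:
  "simplicial_boundary_gen (int (Suc m)) (Some xs)
     = (\<Sum>i\<le>Suc m. frag_cmul ((-1) ^ i) (frag_of (Some (simp_face \<Lambda> i xs))))"
  by (subst simplicial_boundary_eq_faces[symmetric]) (simp_all add: simplicial_boundary_gen_def nat_add_distrib)

lemma simp_gens_cases:
  assumes "g \<in> simp_gens \<Lambda> v n"
  obtains (face) m xs where "n = int (Suc m)" "g = Some xs" "composable \<Lambda> xs" "length xs = Suc (Suc m)"
      "src \<Lambda> (last xs) = v"
  | (vertex) x where "n = 0" "g = Some [x]" "x \<in> Mor \<Lambda>" "src \<Lambda> x = v"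
  | (empty) "n = -1" "g = None"
proof (cases "n \<ge> 0")
  case True
  then obtain xs where xs: "g = Some xs" "composable \<Lambda> xs" "length xs = nat n + 1" "src \<Lambda> (last xs) = v"
    using assms by (auto simp: simp_gens_def)
  show ?thesis
  proof (cases "nat n")
    case 0
    then show ?thesis using xs True vertex[of "hd xs"] by (cases xs) auto
  next
    case (Suc m)
    then show ?thesis using xs True face[of m xs] by auto
  qed
next
  case False
  then show ?thesis using assms empty by (auto simp: simp_gens_def split: if_splits)
qed

lemma Some_in_simp_gens:
  "Some xs \<in> simp_gens \<Lambda> v (int m) \<longleftrightarrow> length xs = Suc m \<and> composable \<Lambda> xs \<and> src \<Lambda> (last xs) = v"
  by (auto simp: simp_gens_def)

lemma None_in_simp_gens: "None \<in> simp_gens \<Lambda> v n \<longleftrightarrow> n = -1"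
  by (auto simp: simp_gens_def)

lemma keys_simplicial_boundary_gen:
  assumes "g \<in> simp_gens \<Lambda> v n"
  shows "Poly_Mapping.keys (simplicial_boundary_gen n g) \<subseteq> simp_gens \<Lambda> v (n - 1)"
  using assms
proof (cases rule: simp_gens_cases)
  case (face m xs)
  show ?thesis unfolding face(1,2) simplicial_boundary_gen_Suc
    using simp_face_closed[OF face(3,4)] face(5)
    by (intro keys_frag_sum_subset keys_signed_generator_subset) (simp add: Some_in_simp_gens)
qed (auto simp: None_in_simp_gens)

lemma simplicial_module_axioms: "right_module \<Lambda> (simplicial_module \<Lambda> n)"
  unfolding simplicial_module_def
proof (rule free_right_module, goal_cases)
  case (1 \<alpha> g)
  from 1(2) show ?case
  proof (cases rule: simp_gens_cases)
    case (face m xs)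
    then have "composable \<Lambda> (butlast xs @ [cmp \<Lambda> (last xs) \<alpha>])"
      using 1(1) by (intro composable_act_last) auto
    then show ?thesis using face 1(1) last_in_Mor[of xs]
      by (simp only: option.map Some_in_simp_gens) (auto simp: src_cmp simp flip: length_0_conv)
  next
    case (vertex x)
    then show ?thesis using 1(1) by (auto simp: simp_gens_def cmp_in src_cmp)
  next
    case empty
    then show ?thesis by (simp add: None_in_simp_gens)
  qed
next
  case (2 v g)
  from 2(2) show ?case
  proof (cases rule: simp_gens_cases)
    case (face m xs)
    then have "xs \<noteq> []" by auto
    then have "cmp \<Lambda> (last xs) v = last xs"
      using cmp_src[OF last_in_Mor, of xs] face by simp
    then show ?thesis using face \<open>xs \<noteq> []\<close> by simp
  qed (auto simp: cmp_src)
next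
  case (3 \<alpha> \<mu> g)
  from 3(4) show ?case
  proof (cases rule: simp_gens_cases)
    case (face m xs)
    then have "last xs \<in> Mor \<Lambda>" by (intro last_in_Mor) auto
    then show ?thesis using face 3 by (simp add: cmp_assoc)
  qed (use 3 in \<open>auto simp: cmp_assoc\<close>)
qed

lemma simplicial_boundary_module_map:
  "module_map \<Lambda> (simplicial_module \<Lambda> n) (simplicial_module \<Lambda> (n - 1)) (simplicial_boundary \<Lambda> n)"
  unfolding simplicial_module_def simplicial_boundary_eq
proof (rule free_module_map, goal_cases)
  case (1 v g)
  then show ?case by (intro keys_simplicial_boundary_gen)
next
  case (2 \<alpha> g)
  from 2(2) show ?case
  proof (cases rule: simp_gens_cases)
    case (face m xs)
    show ?thesis unfolding face(1,2) option.map simplicial_boundary_gen_Suc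
      by (simp add: frag_extend_signed_sum simp_face_act_last[OF face(3,4)] 2(1) face(5) del: sum.atMost_Suc)
  qed auto
qed

lemma simplicial_boundary_boundary:
  assumes "x \<in> carrier (grp (simplicial_module \<Lambda> n) v)"
  shows "simplicial_boundary \<Lambda> (n - 1) v (simplicial_boundary \<Lambda> n v x) = 0"
proof -
  have "frag_extend (simplicial_boundary_gen (n - 1)) (simplicial_boundary_gen n g) = 0" if "g \<in> simp_gens \<Lambda> v n" for g
    using that
  proof (cases rule: simp_gens_cases)
    case (face m xs)
    show ?thesis
    proof (cases m)
      case 0
      then show ?thesis using face by (simp add: simplicial_boundary_gen_Suc[of 0, simplified] frag_extend_diff)
    next
      case (Suc l)
      have "frag_extend (simplicial_boundary_gen (int m)) (simplicial_boundary_gen (int (Suc m)) (Some xs)) =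
         (\<Sum>j\<le>Suc m. \<Sum>i\<le>m. frag_cmul ((-1) ^ (i + j))
             (frag_of (Some (simp_face \<Lambda> i (simp_face \<Lambda> j xs)))))"
        unfolding simplicial_boundary_gen_Suc
        by (simp add: frag_extend_signed_sum Suc simplicial_boundary_gen_Suc[of l] frag_cmul_sum power_add mult.commute
              del: of_nat_Suc sum.atMost_Suc)
      also have "\<dots> = 0"
        using face Suc by (intro presimplicial_double_sum_eq_0) (simp add: simp_face_simp_face)
      finally show ?thesis using face by simp
    qed
  qed auto
  then show ?thesis
    using assms unfolding simplicial_boundary_eq frag_extend_frag_extend
    by (subst frag_extend_eq_0) (auto simp: simplicial_module_def)
qed

lemma simplicial_chain_complex: "chain_complex \<Lambda> (simplicial_module \<Lambda>) (simplicial_boundary \<Lambda>)"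
  unfolding chain_complex_def
  using simplicial_module_axioms simplicial_boundary_module_map simplicial_boundary_boundary
  by (simp add: simplicial_module_def)

end

section \<open>Factorizations into several factors\<close>

context small_category
begin

lemma foldr_cmp_path:
  assumes "composable \<Lambda> (xs @ [\<mu>])"
  shows "foldr (cmp \<Lambda>) xs \<mu> \<in> Mor \<Lambda>" "src \<Lambda> (foldr (cmp \<Lambda>) xs \<mu>) = src \<Lambda> \<mu>"
    "rng \<Lambda> (foldr (cmp \<Lambda>) xs \<mu>) = rng \<Lambda> (hd (xs @ [\<mu>]))"
  using assms
proof (induction xs)
  case (Cons x xs)
  {
    case 1
    then show ?case using Cons by (cases xs) (auto intro: cmp_in)
  next
    case 2
    then show ?case using Cons by (cases xs) (auto simp: src_cmp)
  next
    case 3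
    then show ?case using Cons by (cases xs) (auto simp: rng_cmp)
  }
qed auto

lemma composable_Cons_path:
  "composable \<Lambda> (x # xs @ [\<mu>]) \<longleftrightarrow>
     x \<in> Mor \<Lambda> \<and> composable \<Lambda> (xs @ [\<mu>]) \<and> src \<Lambda> x = rng \<Lambda> (foldr (cmp \<Lambda>) xs \<mu>)"
  using foldr_cmp_path(3)[of xs \<mu>] by (cases xs) (auto simp: rng_cmp)

lemma composable_append_path:
  "composable \<Lambda> (xs @ ys @ [\<mu>]) \<longleftrightarrow>
     composable \<Lambda> (xs @ [foldr (cmp \<Lambda>) ys \<mu>]) \<and> composable \<Lambda> (ys @ [\<mu>])"
proof (induction xs)
  case Nil
  then show ?case using foldr_cmp_path(1) by auto
next
  case (Cons x xs)
  then show ?case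
    using composable_Cons_path[of x "xs @ ys"] by (auto simp: composable_Cons_path)
qed

lemma foldr_cmp_cmp:
  assumes "composable \<Lambda> (xs @ [\<mu>])" "\<nu> \<in> Mor \<Lambda>" "src \<Lambda> \<mu> = rng \<Lambda> \<nu>"
  shows "foldr (cmp \<Lambda>) xs (cmp \<Lambda> \<mu> \<nu>) = cmp \<Lambda> (foldr (cmp \<Lambda>) xs \<mu>) \<nu>"
  using assms
proof (induction xs)
  case (Cons x xs)
  then show ?case by (simp add: composable_Cons_path cmp_assoc foldr_cmp_path)
qed simp

lemma composable_snoc_rng:
  "composable \<Lambda> (xs @ [\<mu>]) \<longleftrightarrow> composable \<Lambda> (xs @ [rng \<Lambda> \<mu>]) \<and> \<mu> \<in> Mor \<Lambda>"
proof (induction xs rule: induct_list012)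
qed (auto simp: rng_in rng_rng)

end

context k_graph
begin

lemma deg_rng: "\<alpha> \<in> Mor \<Lambda> \<Longrightarrow> deg \<Lambda> (rng \<Lambda> \<alpha>) = 0"
  using deg_id[OF rng_in] by (simp add: src_rng)

text \<open>
  The uniqueness half of the factorization property.  Degrees are additive and \<open>\<nat>\<^sup>k\<close> is cancellative,
  so agreement of one pair of degrees forces agreement of the other.
\<close>

lemma cancel:
  assumes "\<mu> \<in> Mor \<Lambda>" "\<nu> \<in> Mor \<Lambda>" "src \<Lambda> \<mu> = rng \<Lambda> \<nu>"
    "\<mu>' \<in> Mor \<Lambda>" "\<nu>' \<in> Mor \<Lambda>" "src \<Lambda> \<mu>' = rng \<Lambda> \<nu>'"
    "cmp \<Lambda> \<mu> \<nu> = cmp \<Lambda> \<mu>' \<nu>'" "deg \<Lambda> \<mu> = deg \<Lambda> \<mu>' \<or> deg \<Lambda> \<nu> = deg \<Lambda> \<nu>'"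
  shows "\<mu> = \<mu>' \<and> \<nu> = \<nu>'"
proof -
  have "deg \<Lambda> \<mu> + deg \<Lambda> \<nu> = deg \<Lambda> \<mu>' + deg \<Lambda> \<nu>'"
    using assms deg_cmp by metis
  then have d: "deg \<Lambda> \<mu> = deg \<Lambda> \<mu>'" "deg \<Lambda> \<nu> = deg \<Lambda> \<nu>'"
    using assms(8) by (metis add_left_cancel add_right_cancel)+
  define P where "P = (\<lambda>(\<mu>1, \<nu>1). \<mu>1 \<in> Mor \<Lambda> \<and> \<nu>1 \<in> Mor \<Lambda> \<and> src \<Lambda> \<mu>1 = rng \<Lambda> \<nu>1 \<and>
        deg \<Lambda> \<mu>1 = deg \<Lambda> \<mu> \<and> deg \<Lambda> \<nu>1 = deg \<Lambda> \<nu> \<and> cmp \<Lambda> \<mu>1 \<nu>1 = cmp \<Lambda> \<mu> \<nu>)"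
  have "\<exists>!p. P p"
    unfolding P_def by (rule factorization[OF cmp_in[OF assms(1-3)] deg_cmp[OF assms(1-3)]])
  moreover have "P (\<mu>, \<nu>)" "P (\<mu>', \<nu>')"
    using assms d by (simp_all add: P_def)
  ultimately have "(\<mu>, \<nu>) = (\<mu>', \<nu>')" by blast
  then show ?thesis by simp
qed

text \<open>
  A morphism \<open>\<alpha>\<close> of degree \<open>0\<close> factors both as \<open>r(\<alpha>)\<alpha>\<close> and as \<open>\<alpha>s(\<alpha>)\<close>, all factors having degree
  \<open>0\<close>.
\<close>

lemma vertex_eq:
  assumes "\<alpha> \<in> Mor \<Lambda>" "deg \<Lambda> \<alpha> = 0"
  shows "rng \<Lambda> \<alpha> = \<alpha>" "src \<Lambda> \<alpha> = \<alpha>"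
  using cancel[of "rng \<Lambda> \<alpha>" \<alpha> \<alpha> "src \<Lambda> \<alpha>"] assms
  by (auto simp: rng_in src_in rng_src src_rng cmp_rng cmp_src deg_rng)

lemma factorE:
  assumes "\<alpha> \<in> Mor \<Lambda>" "deg \<Lambda> \<alpha> = m + n"
  obtains \<mu> \<nu> where "\<mu> \<in> Mor \<Lambda>" "\<nu> \<in> Mor \<Lambda>" "src \<Lambda> \<mu> = rng \<Lambda> \<nu>" "deg \<Lambda> \<mu> = m" "deg \<Lambda> \<nu> = n"
    "\<alpha> = cmp \<Lambda> \<mu> \<nu>"
  using factorization[OF assms] by blast

lemma segment_initial:
  assumes "\<mu> \<in> Mor \<Lambda>" "\<nu> \<in> Mor \<Lambda>" "src \<Lambda> \<mu> = rng \<Lambda> \<nu>"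
  shows "segment \<Lambda> (cmp \<Lambda> \<mu> \<nu>) 0 (deg \<Lambda> \<mu>) = \<mu>"
  unfolding segment_def
proof (rule the_equality, goal_cases)
  case 1
  have "\<exists>\<alpha>'\<in>Mor \<Lambda>. \<exists>\<alpha>''\<in>Mor \<Lambda>. src \<Lambda> \<alpha>' = rng \<Lambda> \<mu> \<and> src \<Lambda> \<mu> = rng \<Lambda> \<alpha>'' \<and>
        deg \<Lambda> \<alpha>' = 0 \<and> cmp \<Lambda> \<mu> \<nu> = cmp \<Lambda> \<alpha>' (cmp \<Lambda> \<mu> \<alpha>'')"
    using assms cmp_rng[OF cmp_in[OF assms]]
    by (intro bexI[of _ "rng \<Lambda> \<mu>"] bexI[of _ \<nu>]) (auto simp: src_rng deg_rng rng_cmp rng_in)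
  then show ?case using assms by (simp add: fun_eq_iff)
next
  case (2 \<tau>)
  then obtain \<alpha>' \<alpha>'' where t: "\<tau> \<in> Mor \<Lambda>" "deg \<Lambda> \<tau> = deg \<Lambda> \<mu>" "\<alpha>' \<in> Mor \<Lambda>" "\<alpha>'' \<in> Mor \<Lambda>"
    "src \<Lambda> \<alpha>' = rng \<Lambda> \<tau>" "src \<Lambda> \<tau> = rng \<Lambda> \<alpha>''" "deg \<Lambda> \<alpha>' = 0"
    "cmp \<Lambda> \<mu> \<nu> = cmp \<Lambda> \<alpha>' (cmp \<Lambda> \<tau> \<alpha>'')"
    by (auto simp: fun_eq_iff)
  have "\<alpha>' = rng \<Lambda> (cmp \<Lambda> \<tau> \<alpha>'')" using vertex_eq(2)[OF t(3,7)] t by (simp add: rng_cmp)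
  then have "cmp \<Lambda> \<mu> \<nu> = cmp \<Lambda> \<tau> \<alpha>''" using t by (simp add: cmp_rng cmp_in)
  then show ?case using cancel[of \<mu> \<nu> \<tau> \<alpha>''] assms t by simp
qed

lemma segment_final:
  assumes "\<mu> \<in> Mor \<Lambda>" "\<nu> \<in> Mor \<Lambda>" "src \<Lambda> \<mu> = rng \<Lambda> \<nu>"
  shows "segment \<Lambda> (cmp \<Lambda> \<mu> \<nu>) (deg \<Lambda> \<mu>) (deg \<Lambda> (cmp \<Lambda> \<mu> \<nu>)) = \<nu>"
proof -
  have deg_diff: "deg \<Lambda> (cmp \<Lambda> \<mu> \<nu>) - deg \<Lambda> \<mu> = deg \<Lambda> \<nu>"
    using assms by (simp add: fun_eq_iff deg_cmp)
  show ?thesis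
    unfolding segment_def deg_diff
  proof (rule the_equality, goal_cases)
    case 1
    have "\<exists>\<alpha>'\<in>Mor \<Lambda>. \<exists>\<alpha>''\<in>Mor \<Lambda>. src \<Lambda> \<alpha>' = rng \<Lambda> \<nu> \<and> src \<Lambda> \<nu> = rng \<Lambda> \<alpha>'' \<and>
          deg \<Lambda> \<alpha>' = deg \<Lambda> \<mu> \<and> cmp \<Lambda> \<mu> \<nu> = cmp \<Lambda> \<alpha>' (cmp \<Lambda> \<nu> \<alpha>'')"
      using assms by (intro bexI[of _ \<mu>] bexI[of _ "src \<Lambda> \<nu>"]) (auto simp: rng_src cmp_src src_in)
    then show ?case using assms by simp
  next
    case (2 \<tau>)
    then obtain \<alpha>' \<alpha>'' where t: "\<tau> \<in> Mor \<Lambda>" "deg \<Lambda> \<tau> = deg \<Lambda> \<nu>" "\<alpha>' \<in> Mor \<Lambda>" "\<alpha>'' \<in> Mor \<Lambda>"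
      "src \<Lambda> \<alpha>' = rng \<Lambda> \<tau>" "src \<Lambda> \<tau> = rng \<Lambda> \<alpha>''" "deg \<Lambda> \<alpha>' = deg \<Lambda> \<mu>"
      "cmp \<Lambda> \<mu> \<nu> = cmp \<Lambda> \<alpha>' (cmp \<Lambda> \<tau> \<alpha>'')"
      by blast
    have *: "\<nu> = cmp \<Lambda> \<tau> \<alpha>''"
      using cancel[of \<mu> \<nu> \<alpha>' "cmp \<Lambda> \<tau> \<alpha>''"] assms t by (simp add: rng_cmp cmp_in)
    then have "deg \<Lambda> \<nu> + deg \<Lambda> \<alpha>'' = deg \<Lambda> \<nu> + 0" using t deg_cmp[of \<tau> \<alpha>''] by simp
    then have "deg \<Lambda> \<alpha>'' = 0" by (simp only: add_left_cancel)
    then have "\<alpha>'' = src \<Lambda> \<tau>" using vertex_eq(1) t by simp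
    then show ?case using * cmp_src[OF t(1)] by simp
  qed
qed

text \<open>
  Appending the identity at the source makes the empty list a factorization of a vertex.
\<close>

definition is_factorization :: "'a \<Rightarrow> (nat \<Rightarrow> nat) list \<Rightarrow> 'a list \<Rightarrow> bool" where
  "is_factorization \<alpha> ds xs \<longleftrightarrow> composable \<Lambda> (xs @ [src \<Lambda> \<alpha>]) \<and> map (deg \<Lambda>) xs = ds \<and>
     foldr (cmp \<Lambda>) xs (src \<Lambda> \<alpha>) = \<alpha>"

definition factors :: "'a \<Rightarrow> (nat \<Rightarrow> nat) list \<Rightarrow> 'a list" where
  "factors \<alpha> ds = (THE xs. is_factorization \<alpha> ds xs)"

text \<open>
  Iterated cancellation: a path is determined by its composite and the degrees of its entries.
\<close>

lemma path_eqI: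
  assumes "composable \<Lambda> (xs @ [\<mu>])" "composable \<Lambda> (ys @ [\<mu>])" "map (deg \<Lambda>) xs = map (deg \<Lambda>) ys"
    "foldr (cmp \<Lambda>) xs \<mu> = foldr (cmp \<Lambda>) ys \<mu>"
  shows "xs = ys"
  using assms
proof (induction xs arbitrary: ys)
  case (Cons x xs)
  then obtain y zs where ys: "ys = y # zs" by auto
  then have "x = y \<and> foldr (cmp \<Lambda>) xs \<mu> = foldr (cmp \<Lambda>) zs \<mu>"
    using Cons.prems by (intro cancel) (auto simp: composable_Cons_path foldr_cmp_path)
  then show ?case using Cons ys by (auto simp: composable_Cons_path)
qed simp

lemma is_factorization_unique:
  "is_factorization \<alpha> ds xs \<Longrightarrow> is_factorization \<alpha> ds ys \<Longrightarrow> xs = ys"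
  unfolding is_factorization_def using path_eqI by auto

lemma factors_eqI: "is_factorization \<alpha> ds xs \<Longrightarrow> factors \<alpha> ds = xs"
  unfolding factors_def using is_factorization_unique by blast

lemma is_factorization_Cons:
  assumes "x \<in> Mor \<Lambda>" "\<beta> \<in> Mor \<Lambda>" "src \<Lambda> x = rng \<Lambda> \<beta>" "is_factorization \<beta> ds xs"
  shows "is_factorization (cmp \<Lambda> x \<beta>) (deg \<Lambda> x # ds) (x # xs)"
  using assms by (auto simp: is_factorization_def composable_Cons_path src_cmp)

lemma is_factorization_snoc:
  assumes "x \<in> Mor \<Lambda>" "\<beta> \<in> Mor \<Lambda>" "src \<Lambda> \<beta> = rng \<Lambda> x" "is_factorization \<beta> ds xs"
  shows "is_factorization (cmp \<Lambda> \<beta> x) (ds @ [deg \<Lambda> x]) (xs @ [x])"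
  using assms foldr_cmp_cmp[of xs "rng \<Lambda> x" x]
  by (auto simp: is_factorization_def src_cmp cmp_src cmp_rng src_rng composable_append_path[of xs "[x]", simplified]
      rng_src src_in composable_snoc_rng[of xs x])

text \<open>
  The existence half of the factorization property, iterated over the list of degrees.
\<close>

lemma ex_factorization:
  assumes "\<alpha> \<in> Mor \<Lambda>" "deg \<Lambda> \<alpha> = sum_list ds"
  shows "\<exists>xs. is_factorization \<alpha> ds xs"
  using assms
proof (induction ds arbitrary: \<alpha>)
  case Nil
  then show ?case
    using vertex_eq(2)[of \<alpha>] by (intro exI[of _ "[]"]) (simp only: is_factorization_def sum_list.Nil, simp)
next
  case (Cons d ds)
  then obtain x \<beta> where "x \<in> Mor \<Lambda>" "\<beta> \<in> Mor \<Lambda>" "src \<Lambda> x = rng \<Lambda> \<beta>" "deg \<Lambda> x = d"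
    "deg \<Lambda> \<beta> = sum_list ds" "\<alpha> = cmp \<Lambda> x \<beta>"
    by (elim factorE[of \<alpha> d "sum_list ds"]) (simp_all only: sum_list.Cons)
  then show ?case using Cons.IH[of \<beta>] is_factorization_Cons by blast
qed

lemma is_factorization_factors:
  "\<alpha> \<in> Mor \<Lambda> \<Longrightarrow> deg \<Lambda> \<alpha> = sum_list ds \<Longrightarrow> is_factorization \<alpha> ds (factors \<alpha> ds)"
  using ex_factorization factors_eqI by metis

lemma factors_Cons:
  assumes "x \<in> Mor \<Lambda>" "\<beta> \<in> Mor \<Lambda>" "src \<Lambda> x = rng \<Lambda> \<beta>" "deg \<Lambda> \<beta> = sum_list ds"
  shows "factors (cmp \<Lambda> x \<beta>) (deg \<Lambda> x # ds) = x # factors \<beta> ds"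
  using assms by (intro factors_eqI is_factorization_Cons is_factorization_factors)

lemma factors_snoc:
  assumes "x \<in> Mor \<Lambda>" "\<beta> \<in> Mor \<Lambda>" "src \<Lambda> \<beta> = rng \<Lambda> x" "deg \<Lambda> \<beta> = sum_list ds"
  shows "factors (cmp \<Lambda> \<beta> x) (ds @ [deg \<Lambda> x]) = factors \<beta> ds @ [x]"
  using assms by (intro factors_eqI is_factorization_snoc is_factorization_factors)

text \<open>
  Composing two neighbouring factors yields a factorization for the list in which the two degrees are
  added, and this factorization is unique.  Since addition of degrees is commutative, the result does
  not depend on the order of \<open>a\<close> and \<open>b\<close>; this is what makes inner faces cancel.
\<close>

lemma merge_at_factors:
  assumes "\<alpha> \<in> Mor \<Lambda>" "deg \<Lambda> \<alpha> = sum_list (ds1 @ a # b # ds2)"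
  shows "merge_at \<Lambda> (Suc (length ds1)) (factors \<alpha> (ds1 @ a # b # ds2)) = factors \<alpha> (ds1 @ (a + b) # ds2)"
proof -
  let ?s = "src \<Lambda> \<alpha>"
  have f: "is_factorization \<alpha> (ds1 @ a # b # ds2) (factors \<alpha> (ds1 @ a # b # ds2))"
    using assms by (rule is_factorization_factors)
  then obtain xs x y ys where xs: "factors \<alpha> (ds1 @ a # b # ds2) = xs @ x # y # ys"
    "map (deg \<Lambda>) xs = ds1" "map (deg \<Lambda>) ys = ds2" "deg \<Lambda> x = a" "deg \<Lambda> y = b"
    unfolding is_factorization_def by (auto simp: map_eq_append_conv map_eq_Cons_conv)
  let ?\<beta> = "foldr (cmp \<Lambda>) ys ?s"
  have comp: "composable \<Lambda> (xs @ x # y # ys @ [?s])" and prod: "foldr (cmp \<Lambda>) (xs @ x # y # ys) ?s = \<alpha>"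
    using f xs by (auto simp: is_factorization_def)
  then have xy: "x \<in> Mor \<Lambda>" "y \<in> Mor \<Lambda>" "?\<beta> \<in> Mor \<Lambda>" "src \<Lambda> x = rng \<Lambda> y" "src \<Lambda> y = rng \<Lambda> ?\<beta>"
    using composable_append_path[of xs "x # y # ys" ?s] composable_Cons_path[of y ys ?s]
    by (auto simp: foldr_cmp_path)
  have "is_factorization \<alpha> (ds1 @ (a + b) # ds2) (xs @ cmp \<Lambda> x y # ys)"
    unfolding is_factorization_def
  proof (intro conjI)
    show "composable \<Lambda> ((xs @ cmp \<Lambda> x y # ys) @ [?s])"
      using composable_merge_at[OF comp, of "Suc (length xs)"] by (simp add: merge_at_append)
    show "map (deg \<Lambda>) (xs @ cmp \<Lambda> x y # ys) = ds1 @ (a + b) # ds2"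
      using xs xy by (simp add: deg_cmp)
    show "foldr (cmp \<Lambda>) (xs @ cmp \<Lambda> x y # ys) ?s = \<alpha>"
      using prod xy by (simp add: cmp_assoc)
  qed
  moreover have "length ds1 = length xs" using xs by auto
  ultimately show ?thesis using xs by (simp add: factors_eqI merge_at_append)
qed

end

section \<open>The sign of a list of numbers\<close>

text \<open>
  The parity of the number of inversions.  In contrast to the sign of a permutation it is compatible
  with adding an entry at either end of the list, without any renumbering.
\<close>

fun inversion_sign :: "nat list \<Rightarrow> int" where
  "inversion_sign [] = 1"
| "inversion_sign (x # xs) = (-1) ^ length (filter (\<lambda>y. y < x) xs) * inversion_sign xs"

lemma inversion_sign_snoc:
  "inversion_sign (xs @ [x]) = (-1) ^ length (filter (\<lambda>y. x < y) xs) * inversion_sign xs"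
  by (induction xs) auto

lemma inversion_sign_sorted: "sorted_wrt (<) xs \<Longrightarrow> inversion_sign xs = 1"
proof (induction xs)
  case (Cons x xs)
  then have "filter (\<lambda>y. y < x) xs = []" by (auto simp: filter_empty_conv)
  then show ?case using Cons by simp
qed simp

lemma inversion_sign_swap_adjacent:
  "x \<noteq> y \<Longrightarrow> inversion_sign (as @ x # y # bs) = - inversion_sign (as @ y # x # bs)"
  by (induction as) auto

text \<open>
  Move \<open>x\<close> past the entries of \<open>bs\<close>, swap it with \<open>y\<close>, and move \<open>y\<close> back: an odd number of swaps of
  neighbours.  The induction peels off one entry of \<open>bs\<close>, which costs two swaps.
\<close>

lemma inversion_sign_swap:
  "distinct (x # y # bs) \<Longrightarrow> inversion_sign (as @ x # bs @ y # cs) = - inversion_sign (as @ y # bs @ x # cs)"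
proof (induction bs arbitrary: as)
  case Nil
  then show ?case using inversion_sign_swap_adjacent[of x y as cs] by simp
next
  case (Cons b bs)
  have "inversion_sign (as @ x # b # bs @ y # cs) = - inversion_sign ((as @ [b]) @ x # bs @ y # cs)"
    using Cons.prems inversion_sign_swap_adjacent[of x b as] by simp
  also have "\<dots> = inversion_sign (as @ b # y # bs @ x # cs)"
    using Cons.prems Cons.IH[of "as @ [b]"] by simp
  also have "\<dots> = - inversion_sign (as @ y # b # bs @ x # cs)"
    using Cons.prems by (intro inversion_sign_swap_adjacent) auto
  finally show ?case by simp
qed

lemma inversion_sign_map_transpose:
  assumes f: "inj_on f {1..n}" and ab: "a \<in> {1..n}" "b \<in> {1..n}" "a < b"
  shows "inversion_sign (map (f \<circ> Transposition.transpose a b) [1..<Suc n]) = - inversion_sign (map f [1..<Suc n])"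
proof -
  let ?t = "Transposition.transpose a b"
  have "[1..<Suc n] = [1..<a] @ [a..<Suc n]"
    using ab upt_add_eq_append[of 1 a "Suc n - a"] by (simp del: upt_Suc)
  also have "[a..<Suc n] = a # [Suc a..<Suc n]" using ab by (simp add: upt_conv_Cons del: upt_Suc)
  also have "[Suc a..<Suc n] = [Suc a..<b] @ [b..<Suc n]"
    using ab upt_add_eq_append[of "Suc a" b "Suc n - b"] by (simp del: upt_Suc)
  also have "[b..<Suc n] = b # [Suc b..<Suc n]" using ab by (simp add: upt_conv_Cons del: upt_Suc)
  finally have l: "[1..<Suc n] = [1..<a] @ a # [Suc a..<b] @ b # [Suc b..<Suc n]" .
  have *: "map (f \<circ> ?t) zs = map f zs" if "a \<notin> set zs" "b \<notin> set zs" for zs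
    using that by (intro map_cong) (auto simp: Transposition.transpose_def)
  have "distinct (map f [1..<Suc n])" using f by (simp add: distinct_map atLeastLessThanSuc_atLeastAtMost del: upt_Suc)
  then have "distinct (f b # f a # map f [Suc a..<b])" unfolding l by auto
  then have "inversion_sign (map f [1..<a] @ f b # map f [Suc a..<b] @ f a # map f [Suc b..<Suc n])
     = - inversion_sign (map f [1..<a] @ f a # map f [Suc a..<b] @ f b # map f [Suc b..<Suc n])"
    by (rule inversion_sign_swap)
  then show ?thesis unfolding l using ab by (simp add: * del: map_map upt_Suc)
qed

text \<open>
  Both sides change by the same sign when \<open>p\<close> is multiplied by a transposition, and transpositions
  generate.  The induction has to range over all injective \<open>f\<close>, since the transposition is absorbed
  into \<open>f\<close>.
\<close>

lemma inversion_sign_map_permutes: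
  assumes "p permutes {1..n}" "inj_on f {1..n}"
  shows "inversion_sign (map (f \<circ> p) [1..<Suc n]) = sign p * inversion_sign (map f [1..<Suc n])"
proof -
  have "finite {1..n}" by simp
  with assms(1) have "\<forall>f. inj_on f {1..n} \<longrightarrow>
      inversion_sign (map (f \<circ> p) [1..<Suc n]) = sign p * inversion_sign (map f [1..<Suc n])"
  proof (induction p rule: permutes_induct)
    case (swap a b p)
    let ?t = "Transposition.transpose a b"
    show ?case
    proof (intro allI impI)
      fix f :: "nat \<Rightarrow> nat" assume f: "inj_on f {1..n}"
      have "inj_on (f \<circ> ?t) {1..n}"
        using f swap by (intro comp_inj_on) (simp_all add: transpose_image_eq)
      then have "inversion_sign (map (f \<circ> (?t \<circ> p)) [1..<Suc n]) = sign p * inversion_sign (map (f \<circ> ?t) [1..<Suc n])"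
        using swap.IH[rule_format, of "f \<circ> ?t"] by (simp only: comp_assoc)
      also have "inversion_sign (map (f \<circ> ?t) [1..<Suc n]) = - inversion_sign (map f [1..<Suc n])"
        using inversion_sign_map_transpose[OF f, of a b] inversion_sign_map_transpose[OF f, of b a] swap.hyps
        by (cases "a < b") (simp_all add: transpose_commute del: upt_Suc)
      also have "sign p * - inversion_sign (map f [1..<Suc n]) = sign (?t \<circ> p) * inversion_sign (map f [1..<Suc n])"
      proof -
        have "permutation p" using \<open>p permutes {1..n}\<close> by (auto simp: permutation_permutes)
        then show ?thesis
          using \<open>a \<noteq> b\<close> by (simp add: sign_compose permutation_swap_id sign_swap_id)
      qed
      finally show "inversion_sign (map (f \<circ> (?t \<circ> p)) [1..<Suc n])
          = sign (?t \<circ> p) * inversion_sign (map f [1..<Suc n])" .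
    qed
  qed simp
  then show ?thesis using assms by blast
qed

section \<open>Sums over orderings of a finite set\<close>

lemma sum_permutations_of_set_Cons:
  assumes "finite A" "A \<noteq> {}"
  shows "(\<Sum>cs\<in>permutations_of_set A. f cs) = (\<Sum>c\<in>A. \<Sum>cs\<in>permutations_of_set (A - {c}). f (c # cs))"
proof -
  have "(\<Sum>c\<in>A. \<Sum>cs\<in>permutations_of_set (A - {c}). f (c # cs))
      = (\<Sum>(c, cs)\<in>Sigma A (\<lambda>c. permutations_of_set (A - {c})). f (c # cs))"
    using assms by (subst sum.Sigma) auto
  also have "\<dots> = (\<Sum>cs\<in>permutations_of_set A. f cs)"
  proof (rule sum.reindex_bij_witness[where i = "\<lambda>cs. (hd cs, tl cs)" and j = "\<lambda>(c, cs). c # cs"], goal_cases)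
    case (2 p)
    then show ?case by (cases p) (auto simp: permutations_of_set_def)
  next
    case (3 cs)
    then show ?case using assms by (cases cs) (auto simp: permutations_of_set_def)
  next
    case (4 cs)
    then show ?case using assms by (cases cs) (auto simp: permutations_of_set_def)
  qed (simp_all add: split_beta)
  finally show ?thesis ..
qed

lemma sum_permutations_of_set_snoc:
  assumes "finite A" "A \<noteq> {}"
  shows "(\<Sum>cs\<in>permutations_of_set A. f cs) = (\<Sum>c\<in>A. \<Sum>cs\<in>permutations_of_set (A - {c}). f (cs @ [c]))"
proof -
  have rev: "(\<Sum>cs\<in>permutations_of_set B. g cs) = (\<Sum>cs\<in>permutations_of_set B. g (rev cs))"
    for B :: "'a set" and g :: "'a list \<Rightarrow> 'b"
    by (rule sum.reindex_bij_witness[where i = rev and j = rev]) (auto simp: permutations_of_set_def)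
  have "(\<Sum>cs\<in>permutations_of_set A. f cs) =
      (\<Sum>c\<in>A. \<Sum>cs\<in>permutations_of_set (A - {c}). f (rev cs @ [c]))"
    by (subst rev, subst sum_permutations_of_set_Cons[OF assms]) simp
  also have "\<dots> = (\<Sum>c\<in>A. \<Sum>cs\<in>permutations_of_set (A - {c}). f (cs @ [c]))"
    by (subst (2) rev) simp
  finally show ?thesis .
qed

text \<open>
  Injectivity suffices, as both sides have \<open>n!\<close> elements.
\<close>

lemma bij_betw_permutes_permutations_of_set:
  assumes "bij_betw f {1..n} A"
  shows "bij_betw (\<lambda>\<sigma>. map (f \<circ> \<sigma>) [1..<Suc n]) {\<sigma>. \<sigma> permutes {1..n}} (permutations_of_set A)"
proof -
  let ?h = "\<lambda>\<sigma>. map (f \<circ> \<sigma>) [1..<Suc n]"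
  have A: "finite A" "card A = n" "inj_on f {1..n}" "f ` {1..n} = A"
    using assms bij_betw_finite[OF assms] bij_betw_same_card[OF assms] by (auto simp: bij_betw_def)
  have set: "set [1..<Suc n] = {1..n}" by auto
  have "inj_on ?h {\<sigma>. \<sigma> permutes {1..n}}"
  proof (rule inj_onI)
    fix \<sigma> \<tau> assume st: "\<sigma> \<in> {\<sigma>. \<sigma> permutes {1..n}}" "\<tau> \<in> {\<sigma>. \<sigma> permutes {1..n}}" "?h \<sigma> = ?h \<tau>"
    show "\<sigma> = \<tau>"
    proof
      fix i
      show "\<sigma> i = \<tau> i"
      proof (cases "i \<in> {1..n}")
        case True
        then have "f (\<sigma> i) = f (\<tau> i)" using st(3) set unfolding map_eq_conv comp_def by blast
        moreover have "\<sigma> i \<in> {1..n}" "\<tau> i \<in> {1..n}"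
          using st(1,2) True by (simp_all only: mem_Collect_eq permutes_in_image)
        ultimately show ?thesis using A(3) by (simp only: inj_on_eq_iff)
      next
        case False
        then show ?thesis using st by (simp add: permutes_not_in)
      qed
    qed
  qed
  moreover have "?h ` {\<sigma>. \<sigma> permutes {1..n}} \<subseteq> permutations_of_set A"
  proof (intro image_subsetI permutations_of_setI)
    fix \<sigma> assume "\<sigma> \<in> {\<sigma>. \<sigma> permutes {1..n}}"
    then have s: "\<sigma> ` {1..n} = {1..n}" "inj_on \<sigma> {1..n}"
      by (auto simp: permutes_image permutes_inj_on)
    show "set (?h \<sigma>) = A" using s(1) A(4) unfolding set_map set image_comp[symmetric] by simp
    show "distinct (?h \<sigma>)"
      unfolding distinct_map set using s A(3) by (intro conjI comp_inj_on distinct_upt) simp_all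
  qed
  moreover have "card {\<sigma>. \<sigma> permutes {1..n}} = card (permutations_of_set A)"
    using A by (simp add: card_permutations)
  ultimately show ?thesis
    unfolding bij_betw_def by (metis card_image card_subset_eq finite_permutations_of_set)
qed

lemma length_filter_permutation:
  assumes "cs \<in> permutations_of_set A"
  shows "length (filter P cs) = card {d \<in> A. P d}"
proof -
  have "distinct (filter P cs)" "set (filter P cs) = {d \<in> A. P d}"
    using assms by (auto simp: permutations_of_set_def)
  then show ?thesis using distinct_card by fastforce
qed

text \<open>
  This turns the position \<open>j\<close> of a colour, which determines signs in the cubical boundary, into a
  number of inversions.
\<close>

lemma card_less_nth_strict_sorted:
  assumes "sorted_wrt (<) (xs :: nat list)" "i < length xs"
  shows "card {d \<in> set xs. d < xs ! i} = i"
proof -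
  have lt: "j < length xs \<Longrightarrow> xs ! j < xs ! i \<longleftrightarrow> j < i" for j
    using assms sorted_wrt_nth_less[OF assms(1)] by (metis linorder_neqE_nat order_less_asym order_less_irrefl)
  have "{d \<in> set xs. d < xs ! i} = (!) xs ` {..<i}"
  proof (intro equalityI subsetI)
    fix d assume "d \<in> {d \<in> set xs. d < xs ! i}"
    then obtain j where "j < length xs" "d = xs ! j" "xs ! j < xs ! i"
      by (auto simp: in_set_conv_nth)
    then show "d \<in> (!) xs ` {..<i}" using lt by simp
  next
    fix d assume "d \<in> (!) xs ` {..<i}"
    then obtain j where "j < i" "d = xs ! j" by auto
    then show "d \<in> {d \<in> set xs. d < xs ! i}" using lt[of j] assms(2) by simp
  qed
  moreover have "inj_on ((!) xs) {..<i}"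
    using assms strict_sorted_iff by (intro inj_on_nth) auto
  ultimately show ?thesis by (simp add: card_image)
qed

definition support :: "'a kgraph \<Rightarrow> 'a \<Rightarrow> nat set" where
  "support \<Lambda> \<alpha> = {i. deg \<Lambda> \<alpha> i \<noteq> 0}"

lemma sum_list_unit_deg:
  "distinct cs \<Longrightarrow> sum_list (map unit_deg cs) = (\<lambda>i. if i \<in> set cs then 1 else 0)"
  by (induction cs) (auto simp: unit_deg_def fun_eq_iff)

lemma inj_unit_deg: "inj unit_deg"
  by (auto simp: inj_def unit_deg_def fun_eq_iff split: if_splits)

lemma colour_permutation:
  assumes "finite (support \<Lambda> \<alpha>)" "card (support \<Lambda> \<alpha>) = n"
  shows "map (colour \<Lambda> \<alpha>) [1..<Suc n] = sorted_list_of_set (support \<Lambda> \<alpha>)"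
    and "bij_betw (colour \<Lambda> \<alpha>) {1..n} (support \<Lambda> \<alpha>)"
    and "j \<in> {1..n} \<Longrightarrow> card {d \<in> support \<Lambda> \<alpha>. d < colour \<Lambda> \<alpha> j} = j - 1"
proof -
  let ?L = "sorted_list_of_set (support \<Lambda> \<alpha>)"
  have c: "colour \<Lambda> \<alpha> j = ?L ! (j - 1)" for j by (simp add: colour_def support_def)
  show m: "map (colour \<Lambda> \<alpha>) [1..<Suc n] = ?L"
    using assms by (intro nth_equalityI) (auto simp: c simp del: upt_Suc)
  have "distinct (map (colour \<Lambda> \<alpha>) [1..<Suc n])" "set (map (colour \<Lambda> \<alpha>) [1..<Suc n]) = support \<Lambda> \<alpha>"
    unfolding m using assms by simp_all
  then show "bij_betw (colour \<Lambda> \<alpha>) {1..n} (support \<Lambda> \<alpha>)"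
    by (simp add: distinct_map bij_betw_def atLeastLessThanSuc_atLeastAtMost del: upt_Suc)
  show "card {d \<in> support \<Lambda> \<alpha>. d < colour \<Lambda> \<alpha> j} = j - 1" if "j \<in> {1..n}"
    using card_less_nth_strict_sorted[of ?L "j - 1"] assms that by (auto simp: c)
qed

section \<open>The k-graph of pairs over a vertex\<close>

lemma tilde_simps [simp]:
  "(\<eta>, \<mu>) \<in> Mor (tilde \<Lambda> v) \<longleftrightarrow> \<eta> \<in> Mor \<Lambda> \<and> \<mu> \<in> Mor \<Lambda> \<and> src \<Lambda> \<eta> = rng \<Lambda> \<mu> \<and> src \<Lambda> \<mu> = v"
  "src (tilde \<Lambda> v) (\<eta>, \<mu>) = (rng \<Lambda> \<mu>, \<mu>)"
  "rng (tilde \<Lambda> v) (\<eta>, \<mu>) = (rng \<Lambda> \<eta>, cmp \<Lambda> \<eta> \<mu>)"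
  "cmp (tilde \<Lambda> v) (\<eta>, \<mu>) (\<eta>', \<mu>') = (cmp \<Lambda> \<eta> \<eta>', \<mu>')"
  "deg (tilde \<Lambda> v) (\<eta>, \<mu>) = deg \<Lambda> \<eta>"
  "support (tilde \<Lambda> v) (\<eta>, \<mu>) = support \<Lambda> \<eta>"
  "colour (tilde \<Lambda> v) (\<eta>, \<mu>) = colour \<Lambda> \<eta>"
  by (simp_all add: tilde_def support_def colour_def fun_eq_iff)

context k_graph
begin

lemma small_category_tilde: "small_category (tilde \<Lambda> v)"
proof -
  have rng: "cmp \<Lambda> (rng \<Lambda> \<eta>) (cmp \<Lambda> \<eta> \<mu>) = cmp \<Lambda> \<eta> \<mu>"
    if "\<eta> \<in> Mor \<Lambda>" "\<mu> \<in> Mor \<Lambda>" "src \<Lambda> \<eta> = rng \<Lambda> \<mu>" for \<eta> \<mu>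
    using cmp_rng[OF cmp_in[OF that]] rng_cmp[OF that] by simp
  have src: "cmp \<Lambda> \<eta> (rng \<Lambda> \<mu>) = \<eta>" if "\<eta> \<in> Mor \<Lambda>" "src \<Lambda> \<eta> = rng \<Lambda> \<mu>" for \<eta> \<mu>
    using cmp_src[OF that(1)] that(2) by simp
  show ?thesis
  proof
    fix \<alpha> \<mu> \<nu>
    show "\<alpha> \<in> Mor (tilde \<Lambda> v) \<Longrightarrow> \<mu> \<in> Mor (tilde \<Lambda> v) \<Longrightarrow> \<nu> \<in> Mor (tilde \<Lambda> v) \<Longrightarrow>
       src (tilde \<Lambda> v) \<alpha> = rng (tilde \<Lambda> v) \<mu> \<Longrightarrow> src (tilde \<Lambda> v) \<mu> = rng (tilde \<Lambda> v) \<nu> \<Longrightarrow>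
       cmp (tilde \<Lambda> v) (cmp (tilde \<Lambda> v) \<alpha> \<mu>) \<nu> = cmp (tilde \<Lambda> v) \<alpha> (cmp (tilde \<Lambda> v) \<mu> \<nu>)"
      by (cases \<alpha>; cases \<mu>; cases \<nu>) (auto simp: cmp_assoc rng_cmp)
  qed (auto simp: rng_in src_in src_rng rng_src rng_rng src_src cmp_in src_cmp rng_cmp cmp_rng cmp_assoc rng src)
qed

text \<open>
  A factorization of \<open>(\<alpha>, \<mu>)\<close> is a factorization \<open>\<alpha> = \<beta>x\<close>, with second components forced to be \<open>x\<mu>\<close>
  and \<open>\<mu>\<close>.
\<close>

lemma k_graph_tilde: "k_graph k (tilde \<Lambda> v)"
proof -
  interpret T: small_category "tilde \<Lambda> v" by (rule small_category_tilde)
  show ?thesis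
  proof
    have "Mor (tilde \<Lambda> v) \<subseteq> Mor \<Lambda> \<times> Mor \<Lambda>" by auto
    then show "countable (Mor (tilde \<Lambda> v))"
      using countable_Mor by (intro countable_subset[of "Mor (tilde \<Lambda> v)" "Mor \<Lambda> \<times> Mor \<Lambda>"] countable_SIGMA countable_Mor)
  next
    fix p m n assume p: "p \<in> Mor (tilde \<Lambda> v)" "deg (tilde \<Lambda> v) p = m + n"
    obtain \<alpha> \<mu> where [simp]: "p = (\<alpha>, \<mu>)" by (cases p)
    obtain \<beta> x where x: "\<beta> \<in> Mor \<Lambda>" "x \<in> Mor \<Lambda>" "src \<Lambda> \<beta> = rng \<Lambda> x" "deg \<Lambda> \<beta> = m" "deg \<Lambda> x = n"
      "\<alpha> = cmp \<Lambda> \<beta> x"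
      using p factorE[of \<alpha> m n] by auto
    show "\<exists>!(\<mu>, \<nu>). \<mu> \<in> Mor (tilde \<Lambda> v) \<and> \<nu> \<in> Mor (tilde \<Lambda> v) \<and> src (tilde \<Lambda> v) \<mu> = rng (tilde \<Lambda> v) \<nu> \<and>
                deg (tilde \<Lambda> v) \<mu> = m \<and> deg (tilde \<Lambda> v) \<nu> = n \<and> cmp (tilde \<Lambda> v) \<mu> \<nu> = p"
    proof (rule ex1I[of _ "((\<beta>, cmp \<Lambda> x \<mu>), (x, \<mu>))"], goal_cases)
      case 1
      then show ?case using p x by (auto simp: cmp_in src_cmp rng_cmp)
    next
      case (2 q)
      then obtain \<beta>' \<mu>1 x' \<mu>2 where q: "q = ((\<beta>', \<mu>1), (x', \<mu>2))" by (metis prod.exhaust)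
      show ?case using 2 x cancel[of \<beta> x \<beta>' x'] unfolding q by auto
    qed
  qed (auto simp: deg_support deg_rng deg_cmp)
qed

lemma segment_tilde_initial:
  assumes "(cmp \<Lambda> \<beta> x, \<mu>) \<in> Mor (tilde \<Lambda> v)" "\<beta> \<in> Mor \<Lambda>" "x \<in> Mor \<Lambda>" "src \<Lambda> \<beta> = rng \<Lambda> x"
  shows "segment (tilde \<Lambda> v) (cmp \<Lambda> \<beta> x, \<mu>) 0 (deg \<Lambda> \<beta>) = (\<beta>, cmp \<Lambda> x \<mu>)"
proof -
  have \<mu>: "src \<Lambda> x = rng \<Lambda> \<mu>" "\<mu> \<in> Mor \<Lambda>" "src \<Lambda> \<mu> = v"
    using assms src_cmp[OF assms(2-4)] by simp_all
  have "(\<beta>, cmp \<Lambda> x \<mu>) \<in> Mor (tilde \<Lambda> v)" "(x, \<mu>) \<in> Mor (tilde \<Lambda> v)"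
    "src (tilde \<Lambda> v) (\<beta>, cmp \<Lambda> x \<mu>) = rng (tilde \<Lambda> v) (x, \<mu>)"
    using assms(2-4) \<mu> by (simp_all add: cmp_in src_cmp rng_cmp)
  from k_graph.segment_initial[OF k_graph_tilde this] show ?thesis by simp
qed

lemma segment_tilde_final:
  assumes "(cmp \<Lambda> x \<beta>, \<mu>) \<in> Mor (tilde \<Lambda> v)" "x \<in> Mor \<Lambda>" "\<beta> \<in> Mor \<Lambda>" "src \<Lambda> x = rng \<Lambda> \<beta>"
  shows "segment (tilde \<Lambda> v) (cmp \<Lambda> x \<beta>, \<mu>) (deg \<Lambda> x) (deg \<Lambda> (cmp \<Lambda> x \<beta>)) = (\<beta>, \<mu>)"
proof -
  have \<mu>: "src \<Lambda> \<beta> = rng \<Lambda> \<mu>" "\<mu> \<in> Mor \<Lambda>" "src \<Lambda> \<mu> = v"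
    using assms src_cmp[OF assms(2-4)] by simp_all
  have "(x, cmp \<Lambda> \<beta> \<mu>) \<in> Mor (tilde \<Lambda> v)" "(\<beta>, \<mu>) \<in> Mor (tilde \<Lambda> v)"
    "src (tilde \<Lambda> v) (x, cmp \<Lambda> \<beta> \<mu>) = rng (tilde \<Lambda> v) (\<beta>, \<mu>)"
    using assms(2-4) \<mu> by (simp_all add: cmp_in src_cmp rng_cmp)
  from k_graph.segment_final[OF k_graph_tilde this] show ?thesis by simp
qed

section \<open>Cubes and their faces\<close>

lemma finite_support: "\<alpha> \<in> Mor \<Lambda> \<Longrightarrow> finite (support \<Lambda> \<alpha>)"
proof (rule finite_subset)
  assume "\<alpha> \<in> Mor \<Lambda>"
  then have "i \<in> {1..k}" if "deg \<Lambda> \<alpha> i \<noteq> 0" for i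
    using deg_support that by metis
  then show "support \<Lambda> \<alpha> \<subseteq> {1..k}" unfolding support_def by (intro subsetI) simp
qed simp

lemma cubes_iff:
  "\<alpha> \<in> cubes \<Lambda> n \<longleftrightarrow> \<alpha> \<in> Mor \<Lambda> \<and> deg \<Lambda> \<alpha> = (\<lambda>i. if i \<in> support \<Lambda> \<alpha> then 1 else 0) \<and>
     card (support \<Lambda> \<alpha>) = n"
proof -
  have "(\<forall>i. deg \<Lambda> \<alpha> i \<in> {0, 1}) \<longleftrightarrow> deg \<Lambda> \<alpha> = (\<lambda>i. if i \<in> support \<Lambda> \<alpha> then 1 else 0)"
  proof -
    have "d \<in> {0, 1} \<longleftrightarrow> d = (if d \<noteq> 0 then 1 else 0)" for d :: nat by auto
    then show ?thesis by (simp only: support_def fun_eq_iff mem_Collect_eq)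
  qed
  moreover have "(\<Sum>i | deg \<Lambda> \<alpha> i \<noteq> 0. deg \<Lambda> \<alpha> i) = card (support \<Lambda> \<alpha>)"
    if "\<forall>i. deg \<Lambda> \<alpha> i \<in> {0, 1}"
  proof -
    have "(\<Sum>i | deg \<Lambda> \<alpha> i \<noteq> 0. deg \<Lambda> \<alpha> i) = (\<Sum>i\<in>support \<Lambda> \<alpha>. 1)"
      unfolding support_def
    proof (rule sum.cong)
      fix i assume "i \<in> {i. deg \<Lambda> \<alpha> i \<noteq> 0}"
      then show "deg \<Lambda> \<alpha> i = 1" using that[rule_format, of i] by simp
    qed simp
    then show ?thesis by simp
  qed
  ultimately show ?thesis unfolding cubes_def by auto
qed

lemma cubeD:
  assumes "\<alpha> \<in> cubes \<Lambda> n"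
  shows "\<alpha> \<in> Mor \<Lambda>" "finite (support \<Lambda> \<alpha>)" "card (support \<Lambda> \<alpha>) = n"
    "cs \<in> permutations_of_set (support \<Lambda> \<alpha>) \<Longrightarrow> deg \<Lambda> \<alpha> = sum_list (map unit_deg cs)"
    "cs \<in> permutations_of_set (support \<Lambda> \<alpha>) \<Longrightarrow> length cs = n"
  using assms finite_support[of \<alpha>] length_finite_permutations_of_set[of cs "support \<Lambda> \<alpha>"]
  by (auto simp: cubes_iff sum_list_unit_deg permutations_of_set_def)

lemma tilde_cubes_iff:
  "(\<alpha>, \<mu>) \<in> cubes (tilde \<Lambda> v) n \<longleftrightarrow> \<alpha> \<in> cubes \<Lambda> n \<and> \<mu> \<in> Mor \<Lambda> \<and> src \<Lambda> \<alpha> = rng \<Lambda> \<mu> \<and> src \<Lambda> \<mu> = v"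
  by (auto simp: cubes_def)

text \<open>
  For a cube \<open>\<alpha>\<close> and a colour \<open>c\<close> in its degree there are two ways to split off an edge of colour
  \<open>c\<close>: \<open>\<alpha> = first_edge \<alpha> c \<cdot> back_face \<alpha> c\<close> and \<open>\<alpha> = front_face \<alpha> c \<cdot> last_edge \<alpha> c\<close>.  The back and
  front face are \<open>F\<^sup>1\<close> and \<open>F\<^sup>0\<close>, indexed by the colour itself rather than by its position.
\<close>

definition first_edge :: "'a \<Rightarrow> nat \<Rightarrow> 'a" where
  "first_edge \<alpha> c = segment \<Lambda> \<alpha> 0 (unit_deg c)"

definition back_face :: "'a \<Rightarrow> nat \<Rightarrow> 'a" where
  "back_face \<alpha> c = segment \<Lambda> \<alpha> (unit_deg c) (deg \<Lambda> \<alpha>)"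

definition front_face :: "'a \<Rightarrow> nat \<Rightarrow> 'a" where
  "front_face \<alpha> c = segment \<Lambda> \<alpha> 0 (deg \<Lambda> \<alpha> - unit_deg c)"

definition last_edge :: "'a \<Rightarrow> nat \<Rightarrow> 'a" where
  "last_edge \<alpha> c = segment \<Lambda> \<alpha> (deg \<Lambda> \<alpha> - unit_deg c) (deg \<Lambda> \<alpha>)"

lemma deg_cube_split:
  assumes "\<alpha> \<in> cubes \<Lambda> n" "c \<in> support \<Lambda> \<alpha>"
  shows "deg \<Lambda> \<alpha> = unit_deg c + (deg \<Lambda> \<alpha> - unit_deg c)"
    "deg \<Lambda> \<alpha> = (deg \<Lambda> \<alpha> - unit_deg c) + unit_deg c"
  using assms by (auto simp: cubes_iff fun_eq_iff unit_deg_def)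

lemma cube_of_complementary_degree:
  assumes "\<alpha> \<in> cubes \<Lambda> (Suc m)" "c \<in> support \<Lambda> \<alpha>" "\<beta> \<in> Mor \<Lambda>" "deg \<Lambda> \<beta> = deg \<Lambda> \<alpha> - unit_deg c"
  shows "\<beta> \<in> cubes \<Lambda> m" "support \<Lambda> \<beta> = support \<Lambda> \<alpha> - {c}"
proof -
  have "deg \<Lambda> \<alpha> = (\<lambda>i. if i \<in> support \<Lambda> \<alpha> then 1 else 0)"
    using assms(1) unfolding cubes_iff by (elim conjE)
  from fun_cong[OF this] have "(deg \<Lambda> \<alpha> - unit_deg c) i = (if i \<in> support \<Lambda> \<alpha> - {c} then 1 else 0)" for i
    using assms(2) by (cases "i = c") (simp_all add: unit_deg_def)
  then have d: "deg \<Lambda> \<beta> = (\<lambda>i. if i \<in> support \<Lambda> \<alpha> - {c} then 1 else 0)"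
    unfolding assms(4) by (rule ext)
  then show s: "support \<Lambda> \<beta> = support \<Lambda> \<alpha> - {c}"
    unfolding support_def[of \<Lambda> \<beta>] by auto
  show "\<beta> \<in> cubes \<Lambda> m"
    using assms d cubeD[OF assms(1)] by (simp add: cubes_iff s)
qed

lemma back_face_split:
  assumes "\<alpha> \<in> cubes \<Lambda> (Suc m)" "c \<in> support \<Lambda> \<alpha>"
  shows "cmp \<Lambda> (first_edge \<alpha> c) (back_face \<alpha> c) = \<alpha>" "first_edge \<alpha> c \<in> Mor \<Lambda>"
    "src \<Lambda> (first_edge \<alpha> c) = rng \<Lambda> (back_face \<alpha> c)" "deg \<Lambda> (first_edge \<alpha> c) = unit_deg c"
    "back_face \<alpha> c \<in> cubes \<Lambda> m" "support \<Lambda> (back_face \<alpha> c) = support \<Lambda> \<alpha> - {c}"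
    "src \<Lambda> (back_face \<alpha> c) = src \<Lambda> \<alpha>"
proof -
  obtain x \<beta> where x: "x \<in> Mor \<Lambda>" "\<beta> \<in> Mor \<Lambda>" "src \<Lambda> x = rng \<Lambda> \<beta>" "deg \<Lambda> x = unit_deg c"
    "deg \<Lambda> \<beta> = deg \<Lambda> \<alpha> - unit_deg c" "\<alpha> = cmp \<Lambda> x \<beta>"
    using factorE[OF cubeD(1)[OF assms(1)] deg_cube_split(1)[OF assms]] by blast
  have "first_edge \<alpha> c = x" "back_face \<alpha> c = \<beta>"
    using segment_initial[OF x(1-3)] segment_final[OF x(1-3)] x
    by (simp_all add: first_edge_def back_face_def)
  then show "cmp \<Lambda> (first_edge \<alpha> c) (back_face \<alpha> c) = \<alpha>" "first_edge \<alpha> c \<in> Mor \<Lambda>"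
    "src \<Lambda> (first_edge \<alpha> c) = rng \<Lambda> (back_face \<alpha> c)" "deg \<Lambda> (first_edge \<alpha> c) = unit_deg c"
    "back_face \<alpha> c \<in> cubes \<Lambda> m" "support \<Lambda> (back_face \<alpha> c) = support \<Lambda> \<alpha> - {c}"
    "src \<Lambda> (back_face \<alpha> c) = src \<Lambda> \<alpha>"
    using cube_of_complementary_degree[OF assms x(2,5)] x(1-4) src_cmp[OF x(1-3)] x(6) by simp_all
qed

lemma front_face_split:
  assumes "\<alpha> \<in> cubes \<Lambda> (Suc m)" "c \<in> support \<Lambda> \<alpha>"
  shows "cmp \<Lambda> (front_face \<alpha> c) (last_edge \<alpha> c) = \<alpha>" "last_edge \<alpha> c \<in> Mor \<Lambda>"
    "src \<Lambda> (front_face \<alpha> c) = rng \<Lambda> (last_edge \<alpha> c)" "deg \<Lambda> (last_edge \<alpha> c) = unit_deg c"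
    "front_face \<alpha> c \<in> cubes \<Lambda> m" "support \<Lambda> (front_face \<alpha> c) = support \<Lambda> \<alpha> - {c}"
    "src \<Lambda> (last_edge \<alpha> c) = src \<Lambda> \<alpha>" "deg \<Lambda> (front_face \<alpha> c) = deg \<Lambda> \<alpha> - unit_deg c"
proof -
  obtain \<beta> x where x: "\<beta> \<in> Mor \<Lambda>" "x \<in> Mor \<Lambda>" "src \<Lambda> \<beta> = rng \<Lambda> x"
    "deg \<Lambda> \<beta> = deg \<Lambda> \<alpha> - unit_deg c" "deg \<Lambda> x = unit_deg c" "\<alpha> = cmp \<Lambda> \<beta> x"
    using factorE[OF cubeD(1)[OF assms(1)] deg_cube_split(2)[OF assms]] by blast
  have "front_face \<alpha> c = \<beta>" "last_edge \<alpha> c = x"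
    using segment_initial[OF x(1-3)] segment_final[OF x(1-3)] x(4,6)
    by (simp_all add: front_face_def last_edge_def)
  then show "cmp \<Lambda> (front_face \<alpha> c) (last_edge \<alpha> c) = \<alpha>" "last_edge \<alpha> c \<in> Mor \<Lambda>"
    "src \<Lambda> (front_face \<alpha> c) = rng \<Lambda> (last_edge \<alpha> c)" "deg \<Lambda> (last_edge \<alpha> c) = unit_deg c"
    "front_face \<alpha> c \<in> cubes \<Lambda> m" "support \<Lambda> (front_face \<alpha> c) = support \<Lambda> \<alpha> - {c}"
    "src \<Lambda> (last_edge \<alpha> c) = src \<Lambda> \<alpha>" "deg \<Lambda> (front_face \<alpha> c) = deg \<Lambda> \<alpha> - unit_deg c"
    using cube_of_complementary_degree[OF assms x(1,4)] x(2-5) src_cmp[OF x(1-3)] x(6) by simp_all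
qed

text \<open>
  The front face moves the source of the cube, so in the graph of pairs the last edge reappears in
  the second component.
\<close>

lemma cube_face_tilde:
  assumes "(\<alpha>, \<mu>) \<in> cubes (tilde \<Lambda> v) (Suc m)" "j \<in> {1..Suc m}"
  shows "cube_face (tilde \<Lambda> v) 0 j (\<alpha>, \<mu>) =
      (front_face \<alpha> (colour \<Lambda> \<alpha> j), cmp \<Lambda> (last_edge \<alpha> (colour \<Lambda> \<alpha> j)) \<mu>)"
    "cube_face (tilde \<Lambda> v) (Suc 0) j (\<alpha>, \<mu>) = (back_face \<alpha> (colour \<Lambda> \<alpha> j), \<mu>)"
proof -
  let ?c = "colour \<Lambda> \<alpha> j"
  have \<alpha>: "\<alpha> \<in> cubes \<Lambda> (Suc m)" and M: "(\<alpha>, \<mu>) \<in> Mor (tilde \<Lambda> v)"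
    using assms by (auto simp: tilde_cubes_iff cubes_def)
  have c: "?c \<in> support \<Lambda> \<alpha>"
    using colour_permutation(2)[OF cubeD(2,3)[OF \<alpha>]] assms(2) by (auto simp: bij_betw_def)
  note f = front_face_split[OF \<alpha> c] and b = back_face_split[OF \<alpha> c]
  show "cube_face (tilde \<Lambda> v) 0 j (\<alpha>, \<mu>) = (front_face \<alpha> ?c, cmp \<Lambda> (last_edge \<alpha> ?c) \<mu>)"
    using segment_tilde_initial[of "front_face \<alpha> ?c" "last_edge \<alpha> ?c" \<mu> v] M f(1,2,3,8) cubeD(1)[OF f(5)]
    by (simp add: cube_face_def)
  show "cube_face (tilde \<Lambda> v) (Suc 0) j (\<alpha>, \<mu>) = (back_face \<alpha> ?c, \<mu>)"
    using segment_tilde_final[of "first_edge \<alpha> ?c" "back_face \<alpha> ?c" \<mu> v] M b(1-4) cubeD(1)[OF b(5)]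
    by (simp add: cube_face_def)
qed

lemma cube_gens_cases:
  assumes "g \<in> cube_gens (tilde \<Lambda> v) n"
  obtains (cube) m \<alpha> \<mu> where "n = int m" "g = Some (\<alpha>, \<mu>)" "\<alpha> \<in> cubes \<Lambda> m" "\<mu> \<in> Mor \<Lambda>"
      "src \<Lambda> \<alpha> = rng \<Lambda> \<mu>" "src \<Lambda> \<mu> = v"
  | (empty) "n = -1" "g = None"
proof (cases "n \<ge> 0")
  case True
  then obtain \<alpha> \<mu> where "g = Some (\<alpha>, \<mu>)" "(\<alpha>, \<mu>) \<in> cubes (tilde \<Lambda> v) (nat n)"
    using assms by (auto simp: cube_gens_def)
  then show ?thesis using cube[of "nat n" \<alpha> \<mu>] True by (simp add: tilde_cubes_iff)
next
  case False
  then show ?thesis using assms empty by (auto simp: cube_gens_def split: if_splits)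
qed

lemma Some_in_cube_gens:
  "Some (\<alpha>, \<mu>) \<in> cube_gens (tilde \<Lambda> v) (int m) \<longleftrightarrow>
     \<alpha> \<in> cubes \<Lambda> m \<and> \<mu> \<in> Mor \<Lambda> \<and> src \<Lambda> \<alpha> = rng \<Lambda> \<mu> \<and> src \<Lambda> \<mu> = v"
  by (auto simp: cube_gens_def tilde_cubes_iff)

lemma None_in_cube_gens: "None \<in> cube_gens \<Gamma> n \<longleftrightarrow> n = -1"
  by (auto simp: cube_gens_def)

definition cubical_boundary_gen :: "'a \<Rightarrow> int \<Rightarrow> ('a \<times> 'a) option \<Rightarrow> ('a \<times> 'a) option \<Rightarrow>\<^sub>0 int" where
  "cubical_boundary_gen v n g = (case g of
     None \<Rightarrow> 0
   | Some \<alpha> \<Rightarrow>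
       if n \<ge> 1 then (\<Sum>j = 1..nat n. \<Sum>l = 0..1.
          frag_cmul ((-1) ^ (j + l)) (frag_of (Some (cube_face (tilde \<Lambda> v) l j \<alpha>))))
       else if n = 0 then frag_of None
       else 0)"

lemma cubical_boundary_eq: "cubical_boundary \<Lambda> n = (\<lambda>v. frag_extend (cubical_boundary_gen v n))"
  unfolding cubical_boundary_def cube_boundary_def cubical_boundary_gen_def by (rule refl)

lemma cubical_boundary_gen_None [simp]: "cubical_boundary_gen v n None = 0"
  by (simp add: cubical_boundary_gen_def)

lemma cubical_boundary_gen_0 [simp]: "cubical_boundary_gen v 0 (Some p) = frag_of None"
  by (simp add: cubical_boundary_gen_def)

text \<open>
  For \<open>c = c\<^sub>j\<close> the exponent is \<open>j - 1\<close>.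
\<close>

definition position_sign :: "nat set \<Rightarrow> nat \<Rightarrow> int" where
  "position_sign A c = (-1) ^ card {d \<in> A. d < c}"

text \<open>
  Summing over colours instead of positions makes the cubical boundary comparable with sums over
  orderings of the colours.
\<close>

lemma cubical_boundary_gen_Suc:
  assumes "\<alpha> \<in> cubes \<Lambda> (Suc m)" "\<mu> \<in> Mor \<Lambda>" "src \<Lambda> \<alpha> = rng \<Lambda> \<mu>" "src \<Lambda> \<mu> = v"
  shows "cubical_boundary_gen v (int (Suc m)) (Some (\<alpha>, \<mu>)) =
    (\<Sum>c\<in>support \<Lambda> \<alpha>. frag_cmul (position_sign (support \<Lambda> \<alpha>) c)
        (frag_of (Some (back_face \<alpha> c, \<mu>)) - frag_of (Some (front_face \<alpha> c, cmp \<Lambda> (last_edge \<alpha> c) \<mu>))))"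
    (is "_ = (\<Sum>c\<in>?A. ?f c)")
proof -
  note col = colour_permutation[OF cubeD(2,3)[OF assms(1)]]
  have p: "(\<alpha>, \<mu>) \<in> cubes (tilde \<Lambda> v) (Suc m)"
    using assms by (simp add: tilde_cubes_iff)
  have "cubical_boundary_gen v (int (Suc m)) (Some (\<alpha>, \<mu>)) = (\<Sum>j = 1..Suc m. \<Sum>l = 0..1.
          frag_cmul ((-1) ^ (j + l)) (frag_of (Some (cube_face (tilde \<Lambda> v) l j (\<alpha>, \<mu>)))))"
    by (simp add: cubical_boundary_gen_def nat_add_distrib)
  also have "\<dots> = (\<Sum>j = 1..Suc m. ?f (colour \<Lambda> \<alpha> j))"
  proof (rule sum.cong)
    fix j assume j: "j \<in> {1..Suc m}"
    then obtain i where i: "j = Suc i" by (cases j) auto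
    have "position_sign ?A (colour \<Lambda> \<alpha> j) = (-1) ^ i"
      using col(3)[OF j] i by (simp add: position_sign_def)
    then show "(\<Sum>l = 0..1. frag_cmul ((-1) ^ (j + l)) (frag_of (Some (cube_face (tilde \<Lambda> v) l j (\<alpha>, \<mu>)))))
        = ?f (colour \<Lambda> \<alpha> j)"
      using cube_face_tilde[OF p j] i
      by (simp add: frag_cmul_diff_right flip: minus_frag_cmul)
  qed simp
  also have "\<dots> = (\<Sum>c\<in>?A. ?f c)"
    by (rule sum.reindex_bij_betw[OF col(2)])
  finally show ?thesis .
qed

lemma keys_cubical_boundary_gen:
  assumes "g \<in> cube_gens (tilde \<Lambda> v) n"
  shows "Poly_Mapping.keys (cubical_boundary_gen v n g) \<subseteq> cube_gens (tilde \<Lambda> v) (n - 1)"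
  using assms
proof (cases rule: cube_gens_cases)
  case (cube m \<alpha> \<mu>)
  show ?thesis
  proof (cases m)
    case 0
    then show ?thesis using cube by (simp add: None_in_cube_gens)
  next
    case (Suc l)
    have \<alpha>: "\<alpha> \<in> cubes \<Lambda> (Suc l)" using cube Suc by simp
    have "Some (back_face \<alpha> c, \<mu>) \<in> cube_gens (tilde \<Lambda> v) (int l)"
      "Some (front_face \<alpha> c, cmp \<Lambda> (last_edge \<alpha> c) \<mu>) \<in> cube_gens (tilde \<Lambda> v) (int l)"
      if c: "c \<in> support \<Lambda> \<alpha>" for c
      using back_face_split[OF \<alpha> c] front_face_split[OF \<alpha> c] cube
      by (simp_all add: Some_in_cube_gens cmp_in src_cmp rng_cmp)
    then have "Poly_Mapping.keys (cubical_boundary_gen v (int (Suc l)) (Some (\<alpha>, \<mu>))) \<subseteq> cube_gens (tilde \<Lambda> v) (int l)"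
      unfolding cubical_boundary_gen_Suc[OF \<alpha> cube(4-6)]
      by (intro keys_frag_sum_subset keys_frag_cmul_diff_subset)
    then show ?thesis using cube Suc by simp
  qed
qed simp

lemma cubical_module_axioms: "right_module \<Lambda> (cubical_module \<Lambda> n)"
  unfolding cubical_module_def
proof (rule free_right_module, goal_cases)
  case (1 \<alpha> g)
  from 1(2) show ?case
  proof (cases rule: cube_gens_cases)
    case (cube m \<beta> \<mu>)
    then show ?thesis using 1(1) by (simp add: Some_in_cube_gens cmp_in rng_cmp src_cmp)
  qed (simp add: None_in_cube_gens)
next
  case (2 v g)
  from 2(2) show ?case
    by (cases rule: cube_gens_cases) (auto simp: cmp_src)
next
  case (3 \<alpha> \<mu> g)
  from 3(4) show ?case
    by (cases rule: cube_gens_cases) (auto simp: cmp_assoc 3)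
qed

lemma cubical_boundary_module_map:
  "module_map \<Lambda> (cubical_module \<Lambda> n) (cubical_module \<Lambda> (n - 1)) (cubical_boundary \<Lambda> n)"
  unfolding cubical_module_def cubical_boundary_eq
proof (rule free_module_map, goal_cases)
  case (1 v g)
  then show ?case by (intro keys_cubical_boundary_gen)
next
  case (2 \<nu> g)
  from 2(2) show ?case
  proof (cases rule: cube_gens_cases)
    case (cube m \<alpha> \<mu>)
    show ?thesis
    proof (cases m)
      case 0
      then show ?thesis using cube by simp
    next
      case (Suc l)
      have \<alpha>: "\<alpha> \<in> cubes \<Lambda> (Suc l)" using cube Suc by simp
      have \<mu>: "cmp \<Lambda> \<mu> \<nu> \<in> Mor \<Lambda>" "src \<Lambda> \<alpha> = rng \<Lambda> (cmp \<Lambda> \<mu> \<nu>)" "src \<Lambda> (cmp \<Lambda> \<mu> \<nu>) = src \<Lambda> \<nu>"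
        using cube 2(1) by (simp_all add: cmp_in rng_cmp src_cmp)
      have "cmp \<Lambda> (cmp \<Lambda> (last_edge \<alpha> c) \<mu>) \<nu> = cmp \<Lambda> (last_edge \<alpha> c) (cmp \<Lambda> \<mu> \<nu>)"
        if "c \<in> support \<Lambda> \<alpha>" for c
        using front_face_split[OF \<alpha> that] cube 2(1) by (simp add: cmp_assoc)
      then show ?thesis
        unfolding cube(1,2) Suc option.map prod.case cubical_boundary_gen_Suc[OF \<alpha> cube(4-6)] cubical_boundary_gen_Suc[OF \<alpha> \<mu>]
        using cubeD(2)[OF \<alpha>] by (simp add: frag_extend_signed_sum frag_extend_diff)
    qed
  qed simp
qed

section \<open>The comparison map\<close>

lemma edge_factors_eq_factors:
  "edge_factors \<Lambda> n \<alpha> \<sigma> = factors \<alpha> (map unit_deg (map (colour \<Lambda> \<alpha> \<circ> \<sigma>) [1..<Suc n]))"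
proof -
  have "length xs = n \<and> (\<forall>i\<in>{1..n}. deg \<Lambda> (xs ! (i - 1)) = unit_deg (colour \<Lambda> \<alpha> (\<sigma> i))) \<longleftrightarrow>
      map (deg \<Lambda>) xs = map unit_deg (map (colour \<Lambda> \<alpha> \<circ> \<sigma>) [1..<Suc n])" for xs
  proof -
    have *: "(\<forall>i\<in>{1..n}. P i) \<longleftrightarrow> (\<forall>i<n. P (Suc i))" for P
      unfolding image_Suc_lessThan[symmetric] by blast
    show ?thesis
      unfolding list_eq_iff_nth_eq * by (rule conj_cong) (simp_all del: upt_Suc)
  qed
  then show ?thesis
    unfolding edge_factors_def factors_def is_factorization_def
    by (intro arg_cong[of _ _ The] ext) blast
qed

definition comparison_gen :: "int \<Rightarrow> ('a \<times> 'a) option \<Rightarrow> 'a list option \<Rightarrow>\<^sub>0 int" where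
  "comparison_gen n g = (case g of
     None \<Rightarrow> if n = -1 then frag_of None else 0
   | Some (\<alpha>, \<mu>) \<Rightarrow>
       if n \<ge> 0 then (\<Sum>\<sigma> | \<sigma> permutes {1..nat n}.
          frag_cmul (sign \<sigma>) (frag_of (Some (edge_factors \<Lambda> (nat n) \<alpha> \<sigma> @ [\<mu>]))))
       else 0)"

lemma comparison_eq: "comparison \<Lambda> n = (\<lambda>v. frag_extend (comparison_gen n))"
  unfolding comparison_def comparison_gen_def by (rule refl)

lemma comparison_gen_None: "comparison_gen n None = (if n = -1 then frag_of None else 0)"
  by (simp add: comparison_gen_def)

text \<open>
  The edges met when the cube \<open>\<alpha>\<close> is traversed with its colours in the order \<open>cs\<close>.
\<close>

definition edge_path :: "'a \<Rightarrow> nat list \<Rightarrow> 'a list" where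
  "edge_path \<alpha> cs = factors \<alpha> (map unit_deg cs)"

text \<open>
  The orderings of the colours correspond to the permutations \<open>\<sigma>\<close> through \<open>j \<mapsto> c\<^bsub>\<sigma>(j)\<^esub>\<close>; as the colours
  \<open>c\<^sub>1 < c\<^sub>2 < \<dots>\<close> have no inversions, the signs agree.
\<close>

lemma comparison_gen_cube:
  assumes "\<alpha> \<in> cubes \<Lambda> m"
  shows "comparison_gen (int m) (Some (\<alpha>, \<mu>)) = (\<Sum>cs\<in>permutations_of_set (support \<Lambda> \<alpha>).
     frag_cmul (inversion_sign cs) (frag_of (Some (edge_path \<alpha> cs @ [\<mu>]))))"
proof -
  let ?A = "support \<Lambda> \<alpha>" and ?c = "colour \<Lambda> \<alpha>"
  note col = colour_permutation[OF cubeD(2,3)[OF assms]]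
  let ?f = "\<lambda>cs. frag_cmul (inversion_sign cs) (frag_of (Some (edge_path \<alpha> cs @ [\<mu>])))"
  have "comparison_gen (int m) (Some (\<alpha>, \<mu>)) =
     (\<Sum>\<sigma> | \<sigma> permutes {1..m}. ?f (map (?c \<circ> \<sigma>) [1..<Suc m]))"
  proof -
    have "inversion_sign (map (?c \<circ> \<sigma>) [1..<Suc m]) = sign \<sigma>" if "\<sigma> permutes {1..m}" for \<sigma>
    proof -
      have "inversion_sign (map ?c [1..<Suc m]) = 1"
        unfolding col(1) by (intro inversion_sign_sorted strict_sorted_list_of_set)
      then show ?thesis
        using inversion_sign_map_permutes[OF that, of ?c] col(2) by (simp add: bij_betw_def del: upt_Suc)
    qed
    then show ?thesis
      by (simp add: comparison_gen_def edge_factors_eq_factors edge_path_def del: upt_Suc)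
  qed
  also have "\<dots> = (\<Sum>cs\<in>permutations_of_set ?A. ?f cs)"
    by (rule sum.reindex_bij_betw[OF bij_betw_permutes_permutations_of_set[OF col(2)]])
  finally show ?thesis .
qed

lemma is_factorization_edge_path:
  assumes "\<alpha> \<in> cubes \<Lambda> m" "cs \<in> permutations_of_set (support \<Lambda> \<alpha>)"
  shows "is_factorization \<alpha> (map unit_deg cs) (edge_path \<alpha> cs)" "length (edge_path \<alpha> cs) = m"
proof -
  show f: "is_factorization \<alpha> (map unit_deg cs) (edge_path \<alpha> cs)"
    unfolding edge_path_def using cubeD[OF assms(1)] assms(2)
    by (intro is_factorization_factors) auto
  then show "length (edge_path \<alpha> cs) = m"
    unfolding is_factorization_def using cubeD(5)[OF assms] by (metis length_map)
qed

lemma edge_path_in_simp_gens: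
  assumes "\<alpha> \<in> cubes \<Lambda> m" "cs \<in> permutations_of_set (support \<Lambda> \<alpha>)"
    and "\<mu> \<in> Mor \<Lambda>" "src \<Lambda> \<alpha> = rng \<Lambda> \<mu>" "src \<Lambda> \<mu> = v"
  shows "Some (edge_path \<alpha> cs @ [\<mu>]) \<in> simp_gens \<Lambda> v (int m)"
  using is_factorization_edge_path[OF assms(1,2)] assms(3-) composable_snoc_rng[of "edge_path \<alpha> cs" \<mu>]
  by (simp add: Some_in_simp_gens is_factorization_def)

lemma comparison_module_map:
  "module_map \<Lambda> (cubical_module \<Lambda> n) (simplicial_module \<Lambda> n) (comparison \<Lambda> n)"
  unfolding cubical_module_def simplicial_module_def comparison_eq
proof (rule free_module_map, goal_cases)
  case (1 v g)
  from 1(2) show ?case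
  proof (cases rule: cube_gens_cases)
    case (cube m \<alpha> \<mu>)
    show ?thesis unfolding cube(1,2) comparison_gen_cube[OF cube(3)]
      using cube by (intro keys_frag_sum_subset keys_signed_generator_subset edge_path_in_simp_gens) auto
  qed (simp add: comparison_gen_None None_in_simp_gens)
next
  case (2 \<nu> g)
  from 2(2) show ?case
  proof (cases rule: cube_gens_cases)
    case (cube m \<alpha> \<mu>)
    show ?thesis unfolding cube(1,2) option.map prod.case comparison_gen_cube[OF cube(3)]
      by (simp add: frag_extend_signed_sum)
  qed (simp add: comparison_gen_None)
qed

section \<open>The chain map identity\<close>

lemma edge_path_Cons:
  assumes "\<alpha> \<in> cubes \<Lambda> (Suc m)" "c \<in> support \<Lambda> \<alpha>" "cs \<in> permutations_of_set (support \<Lambda> \<alpha> - {c})"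
  shows "edge_path \<alpha> (c # cs) = first_edge \<alpha> c # edge_path (back_face \<alpha> c) cs"
proof -
  note b = back_face_split[OF assms(1,2)]
  show ?thesis
    using factors_Cons[of "first_edge \<alpha> c" "back_face \<alpha> c" "map unit_deg cs"] b(1-4) cubeD(1)[OF b(5)] cubeD(4)[OF b(5), of cs]
      assms(3) by (simp add: edge_path_def b(6))
qed

lemma edge_path_snoc:
  assumes "\<alpha> \<in> cubes \<Lambda> (Suc m)" "c \<in> support \<Lambda> \<alpha>" "cs \<in> permutations_of_set (support \<Lambda> \<alpha> - {c})"
  shows "edge_path \<alpha> (cs @ [c]) = edge_path (front_face \<alpha> c) cs @ [last_edge \<alpha> c]"
proof -
  note f = front_face_split[OF assms(1,2)]
  show ?thesis
    using factors_snoc[of "last_edge \<alpha> c" "front_face \<alpha> c" "map unit_deg cs"] f(1-4) cubeD(1)[OF f(5)] cubeD(4)[OF f(5), of cs]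
      assms(3) by (simp add: edge_path_def f(6))
qed

lemma merge_at_edge_path_swap:
  assumes "\<alpha> \<in> cubes \<Lambda> m" "as @ c # d # bs \<in> permutations_of_set (support \<Lambda> \<alpha>)"
  shows "merge_at \<Lambda> (Suc (length as)) (edge_path \<alpha> (as @ c # d # bs) @ [\<mu>]) =
         merge_at \<Lambda> (Suc (length as)) (edge_path \<alpha> (as @ d # c # bs) @ [\<mu>])"
proof -
  have *: "merge_at \<Lambda> (Suc (length as)) (edge_path \<alpha> (as @ c # d # bs) @ [\<mu>]) =
     factors \<alpha> (map unit_deg as @ (unit_deg c + unit_deg d) # map unit_deg bs) @ [\<mu>]"
    if p: "as @ c # d # bs \<in> permutations_of_set (support \<Lambda> \<alpha>)" for c d
  proof -
    have "length (edge_path \<alpha> (as @ c # d # bs)) = length (as @ c # d # bs)"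
      using is_factorization_edge_path(2)[OF assms(1) p] cubeD(5)[OF assms(1) p] by simp
    moreover have "deg \<Lambda> \<alpha> = sum_list (map unit_deg as @ unit_deg c # unit_deg d # map unit_deg bs)"
      using cubeD(4)[OF assms(1) p] by (simp only: map_append list.map)
    ultimately show ?thesis
      using merge_at_factors[OF cubeD(1)[OF assms(1)], of "map unit_deg as" "unit_deg c" "unit_deg d" "map unit_deg bs"]
      by (simp add: merge_at_append_left edge_path_def)
  qed
  have "as @ d # c # bs \<in> permutations_of_set (support \<Lambda> \<alpha>)"
    using assms(2) by (auto simp: permutations_of_set_def)
  from *[OF assms(2)] *[OF this] show ?thesis by (simp add: add.commute)
qed

text \<open>
  Exchanging the colours at positions \<open>i\<close> and \<open>i + 1\<close> is an involution on the orderings that preserves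
  the face and reverses its sign; so the sum is its own negative.
\<close>

lemma inner_faces_cancel:
  assumes "\<alpha> \<in> cubes \<Lambda> m" "0 < i" "i < m"
  shows "(\<Sum>cs\<in>permutations_of_set (support \<Lambda> \<alpha>).
      frag_cmul (inversion_sign cs) (frag_of (Some (simp_face \<Lambda> i (edge_path \<alpha> cs @ [\<mu>]))))) = 0"
    (is "(\<Sum>cs\<in>?P. ?h cs) = 0")
proof -
  let ?swap = "\<lambda>cs. cs[i - 1 := cs ! i, i := cs ! (i - 1)]"
  have split: "\<exists>as c d bs. cs = as @ c # d # bs \<and> length as = i - 1 \<and> ?swap cs = as @ d # c # bs \<and> c \<noteq> d"
    if P: "cs \<in> ?P" for cs
  proof -
    have l: "i - 1 < length cs" "Suc (i - 1) < length cs"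
      using cubeD(5)[OF assms(1) P] assms by simp_all
    obtain as c d bs where cs: "cs = as @ c # d # bs" "length as = i - 1"
    proof (rule that)
      show "cs = take (i - 1) cs @ cs ! (i - 1) # cs ! Suc (i - 1) # drop (Suc (Suc (i - 1))) cs"
        unfolding Cons_nth_drop_Suc[OF l(2)] by (rule id_take_nth_drop[OF l(1)])
      show "length (take (i - 1) cs) = i - 1" using l by simp
    qed
    moreover have "i = Suc (length as)" using cs assms by simp
    moreover have "c \<noteq> d" using P cs by (auto simp: permutations_of_set_def)
    ultimately show ?thesis
      by (intro exI[of _ as] exI[of _ c] exI[of _ d] exI[of _ bs]) (simp add: list_update_append nth_append)
  qed
  have swap: "?swap cs \<in> ?P" "?swap (?swap cs) = cs" "?h (?swap cs) = - ?h cs" if P: "cs \<in> ?P" for cs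
  proof -
    obtain as c d bs where cs: "cs = as @ c # d # bs" "length as = i - 1" "?swap cs = as @ d # c # bs" "c \<noteq> d"
      using split[OF P] by blast
    have i: "i = Suc (length as)" using cs assms by simp
    show P': "?swap cs \<in> ?P" unfolding cs(3) using P cs(1) by (auto simp: permutations_of_set_def)
    show "?swap (?swap cs) = cs"
      unfolding cs(3) using cs(1) i by (simp add: list_update_append nth_append)
    have "simp_face \<Lambda> i (edge_path \<alpha> (as @ d # c # bs) @ [\<mu>]) = simp_face \<Lambda> i (edge_path \<alpha> cs @ [\<mu>])"
      using merge_at_edge_path_swap[OF assms(1), of as c d bs] P unfolding cs(1) i by (simp add: simp_face_def)
    moreover have "inversion_sign (as @ d # c # bs) = - inversion_sign cs"
      unfolding cs(1) using cs(4) by (intro inversion_sign_swap_adjacent) simp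
    ultimately show "?h (?swap cs) = - ?h cs"
      unfolding cs(3) by (simp only: minus_frag_cmul)
  qed
  have "(\<Sum>cs\<in>?P. ?h cs) = (\<Sum>cs\<in>?P. - ?h cs)"
    by (rule sum.reindex_bij_witness[where i = ?swap and j = ?swap]) (simp_all only: swap minus_minus)
  then have "(\<Sum>cs\<in>?P. ?h cs) = - (\<Sum>cs\<in>?P. ?h cs)"
    by (simp only: sum_negf)
  then show ?thesis by (simp only: frag_eq_minus_self_iff)
qed

text \<open>
  An ordering of the colours is a first colour \<open>c\<close> followed by an ordering of the others, that is, of
  the colours of the back face.  The inversions involving \<open>c\<close> are the colours below \<open>c\<close>.
\<close>

lemma first_faces_sum:
  assumes "\<alpha> \<in> cubes \<Lambda> (Suc m)"
  shows "(\<Sum>cs\<in>permutations_of_set (support \<Lambda> \<alpha>).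
      frag_cmul (inversion_sign cs) (frag_of (Some (simp_face \<Lambda> 0 (edge_path \<alpha> cs @ [\<mu>])))))
    = (\<Sum>c\<in>support \<Lambda> \<alpha>. frag_cmul (position_sign (support \<Lambda> \<alpha>) c)
          (comparison_gen (int m) (Some (back_face \<alpha> c, \<mu>))))"
proof -
  let ?A = "support \<Lambda> \<alpha>"
  have A: "finite ?A" "?A \<noteq> {}" using cubeD(2,3)[OF assms] by auto
  show ?thesis
    unfolding sum_permutations_of_set_Cons[OF A]
  proof (rule sum.cong)
    fix c assume c: "c \<in> ?A"
    note b = back_face_split[OF assms c]
    have "inversion_sign (c # cs) = position_sign ?A c * inversion_sign cs"
      if "cs \<in> permutations_of_set (?A - {c})" for cs
    proof -
      have "{d \<in> ?A - {c}. d < c} = {d \<in> ?A. d < c}" by auto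
      then show ?thesis using length_filter_permutation[OF that] by (simp add: position_sign_def)
    qed
    then show "(\<Sum>cs\<in>permutations_of_set (?A - {c}). frag_cmul (inversion_sign (c # cs))
          (frag_of (Some (simp_face \<Lambda> 0 (edge_path \<alpha> (c # cs) @ [\<mu>])))))
        = frag_cmul (position_sign ?A c) (comparison_gen (int m) (Some (back_face \<alpha> c, \<mu>)))"
      unfolding comparison_gen_cube[OF b(5)] b(6) frag_cmul_sum
      by (intro sum.cong) (simp_all add: edge_path_Cons[OF assms c] simp_face_def del: inversion_sign.simps)
  qed simp
qed

text \<open>
  An ordering is an ordering of the colours of the front face followed by a last colour \<open>c\<close>.  Now the
  inversions involving \<open>c\<close> are the colours above \<open>c\<close>.  There are \<open>m\<close> colours other than \<open>c\<close>, so
  together with the sign of the last simplicial face this leaves the negative of the parity of the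
  number of colours below \<open>c\<close>.
\<close>

lemma last_faces_sum:
  assumes "\<alpha> \<in> cubes \<Lambda> (Suc m)"
  shows "frag_cmul ((-1) ^ Suc m) (\<Sum>cs\<in>permutations_of_set (support \<Lambda> \<alpha>).
      frag_cmul (inversion_sign cs) (frag_of (Some (simp_face \<Lambda> (Suc m) (edge_path \<alpha> cs @ [\<mu>])))))
    = - (\<Sum>c\<in>support \<Lambda> \<alpha>. frag_cmul (position_sign (support \<Lambda> \<alpha>) c)
          (comparison_gen (int m) (Some (front_face \<alpha> c, cmp \<Lambda> (last_edge \<alpha> c) \<mu>))))"
proof -
  let ?A = "support \<Lambda> \<alpha>"
  have A: "finite ?A" "?A \<noteq> {}" "card ?A = Suc m" using cubeD(2,3)[OF assms] by auto
  show ?thesis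
    unfolding sum_permutations_of_set_snoc[OF A(1,2)] frag_cmul_sum sum_negf[symmetric]
  proof (rule sum.cong)
    fix c assume c: "c \<in> ?A"
    note f = front_face_split[OF assms c]
    have sgn: "(-1) ^ Suc m * inversion_sign (cs @ [c]) = - position_sign ?A c * inversion_sign cs"
      if "cs \<in> permutations_of_set (?A - {c})" for cs
    proof -
      let ?l = "card {d \<in> ?A. d < c}" and ?g = "card {d \<in> ?A. c < d}"
      have "?A - {c} = {d \<in> ?A. d < c} \<union> {d \<in> ?A. c < d}" by auto
      moreover have "card ({d \<in> ?A. d < c} \<union> {d \<in> ?A. c < d}) = ?l + ?g"
        using A(1) by (intro card_Un_disjoint) (simp_all add: disjoint_iff)
      moreover have "card (?A - {c}) = m" using A c by simp
      ultimately have m: "m = ?l + ?g" by simp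
      have "{d \<in> ?A - {c}. c < d} = {d \<in> ?A. c < d}" by auto
      then have "inversion_sign (cs @ [c]) = (-1) ^ ?g * inversion_sign cs"
        using length_filter_permutation[OF that] by (simp add: inversion_sign_snoc)
      moreover have "(-1) ^ Suc m * (-1) ^ ?g = - ((-1 :: int) ^ ?l)"
        unfolding m by (simp add: power_add)
      ultimately show ?thesis by (simp add: position_sign_def flip: mult.assoc)
    qed
    have face: "simp_face \<Lambda> (Suc m) (edge_path \<alpha> (cs @ [c]) @ [\<mu>]) =
        edge_path (front_face \<alpha> c) cs @ [cmp \<Lambda> (last_edge \<alpha> c) \<mu>]"
      if "cs \<in> permutations_of_set (?A - {c})" for cs
      using merge_at_append[of \<Lambda> "edge_path (front_face \<alpha> c) cs" "last_edge \<alpha> c" \<mu> "[]"]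
        is_factorization_edge_path(2)[OF f(5), of cs] that
      by (simp add: simp_face_def edge_path_snoc[OF assms c] f(6))
    show "(\<Sum>cs\<in>permutations_of_set (?A - {c}). frag_cmul ((-1) ^ Suc m) (frag_cmul (inversion_sign (cs @ [c]))
          (frag_of (Some (simp_face \<Lambda> (Suc m) (edge_path \<alpha> (cs @ [c]) @ [\<mu>]))))))
        = - frag_cmul (position_sign ?A c) (comparison_gen (int m) (Some (front_face \<alpha> c, cmp \<Lambda> (last_edge \<alpha> c) \<mu>)))"
      unfolding comparison_gen_cube[OF f(5)] f(6) frag_cmul_sum sum_negf[symmetric]
      by (intro sum.cong) (simp_all only: frag_cmul_cmul minus_frag_cmul sgn face mult_minus_left)
  qed simp
qed

lemma comparison_boundary_on_generators:
  assumes "g \<in> cube_gens (tilde \<Lambda> v) n"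
  shows "frag_extend (comparison_gen (n - 1)) (cubical_boundary_gen v n g) = frag_extend (simplicial_boundary_gen n) (comparison_gen n g)"
  using assms
proof (cases rule: cube_gens_cases)
  case (cube m \<alpha> \<mu>)
  show ?thesis
  proof (cases m)
    case 0
    then have "support \<Lambda> \<alpha> = {}" using cubeD(2,3)[OF cube(3)] by auto
    then show ?thesis
      using cube 0 comparison_gen_cube[OF cube(3), of \<mu>] by (simp add: comparison_gen_None)
  next
    case (Suc l)
    let ?A = "support \<Lambda> \<alpha>" and ?\<epsilon> = "position_sign (support \<Lambda> \<alpha>)"
    let ?S = "\<lambda>i. \<Sum>cs\<in>permutations_of_set ?A.
        frag_cmul (inversion_sign cs) (frag_of (Some (simp_face \<Lambda> i (edge_path \<alpha> cs @ [\<mu>]))))"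
    have \<alpha>: "\<alpha> \<in> cubes \<Lambda> (Suc l)" using cube Suc by simp
    have "frag_extend (simplicial_boundary_gen (int (Suc l))) (comparison_gen (int (Suc l)) (Some (\<alpha>, \<mu>)))
      = (\<Sum>cs\<in>permutations_of_set ?A. \<Sum>i\<le>Suc l. frag_cmul ((-1) ^ i) (frag_cmul (inversion_sign cs)
          (frag_of (Some (simp_face \<Lambda> i (edge_path \<alpha> cs @ [\<mu>]))))))"
      unfolding comparison_gen_cube[OF \<alpha>]
      by (simp add: frag_extend_signed_sum simplicial_boundary_gen_Suc frag_cmul_sum mult.commute
               del: sum.atMost_Suc of_nat_Suc)
    also have "\<dots> = (\<Sum>i\<le>Suc l. frag_cmul ((-1) ^ i) (?S i))"
      unfolding frag_cmul_sum by (rule sum.swap)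
    also have "\<dots> = (\<Sum>i\<in>{0, Suc l}. frag_cmul ((-1) ^ i) (?S i))"
      using inner_faces_cancel[OF \<alpha>, of _ \<mu>] by (intro sum.mono_neutral_right) auto
    also have "\<dots> = ?S 0 + frag_cmul ((-1) ^ Suc l) (?S (Suc l))"
      by simp
    also have "\<dots> = (\<Sum>c\<in>?A. frag_cmul (?\<epsilon> c) (comparison_gen (int l) (Some (back_face \<alpha> c, \<mu>))))
       - (\<Sum>c\<in>?A. frag_cmul (?\<epsilon> c) (comparison_gen (int l) (Some (front_face \<alpha> c, cmp \<Lambda> (last_edge \<alpha> c) \<mu>))))"
      unfolding first_faces_sum[OF \<alpha>] last_faces_sum[OF \<alpha>] by simp
    also have "\<dots> = frag_extend (comparison_gen (int l)) (cubical_boundary_gen v (int (Suc l)) (Some (\<alpha>, \<mu>)))"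
      unfolding cubical_boundary_gen_Suc[OF \<alpha> cube(4-6)]
      using cubeD(2)[OF \<alpha>]
      by (simp add: frag_extend_signed_sum frag_extend_diff frag_cmul_diff_right sum_subtractf)
    finally show ?thesis using cube Suc by simp
  qed
qed (simp add: comparison_gen_None)

lemma comparison_boundary:
  assumes "x \<in> carrier (grp (cubical_module \<Lambda> n) v)"
  shows "comparison \<Lambda> (n - 1) v (cubical_boundary \<Lambda> n v x) = simplicial_boundary \<Lambda> n v (comparison \<Lambda> n v x)"
  unfolding comparison_eq cubical_boundary_eq simplicial_boundary_eq
  by (rule frag_extend_comp_eq_on_generators[where G = "cube_gens (tilde \<Lambda> v) n"])
     (use assms comparison_boundary_on_generators in \<open>auto simp: cubical_module_def\<close>)

section \<open>The cubical complex is a complex\<close>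

text \<open>
  A left inverse of the comparison map: it recovers the cube from its simplex with increasing colours
  and annihilates the other simplices.
\<close>

definition comparison_retraction :: "'a list option \<Rightarrow> ('a \<times> 'a) option \<Rightarrow>\<^sub>0 int" where
  "comparison_retraction g = (case g of
     None \<Rightarrow> frag_of None
   | Some xs \<Rightarrow> let \<alpha> = foldr (cmp \<Lambda>) (butlast xs) (rng \<Lambda> (last xs)) in
       if butlast xs = edge_path \<alpha> (sorted_list_of_set (support \<Lambda> \<alpha>)) then frag_of (Some (\<alpha>, last xs)) else 0)"

text \<open>
  The degrees of the entries of a path determine the ordering \<open>cs\<close>, so exactly one simplex of the cube
  survives, and its sign is \<open>1\<close>.
\<close>

lemma retraction_comparison_on_generators:
  assumes "g \<in> cube_gens (tilde \<Lambda> v) n"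
  shows "frag_extend comparison_retraction (comparison_gen n g) = frag_of g"
  using assms
proof (cases rule: cube_gens_cases)
  case (cube m \<alpha> \<mu>)
  let ?A = "support \<Lambda> \<alpha>" and ?ord = "sorted_list_of_set (support \<Lambda> \<alpha>)"
  have ord: "?ord \<in> permutations_of_set ?A"
    using cubeD(2)[OF cube(3)] by (intro permutations_of_setI) auto
  have r: "comparison_retraction (Some (edge_path \<alpha> cs @ [\<mu>])) = (if cs = ?ord then frag_of (Some (\<alpha>, \<mu>)) else 0)"
    if cs: "cs \<in> permutations_of_set ?A" for cs
  proof -
    note f = is_factorization_edge_path(1)[OF cube(3) cs] and f' = is_factorization_edge_path(1)[OF cube(3) ord]
    have "foldr (cmp \<Lambda>) (edge_path \<alpha> cs) (rng \<Lambda> \<mu>) = \<alpha>"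
      using f cube by (simp add: is_factorization_def)
    moreover have "edge_path \<alpha> cs = edge_path \<alpha> ?ord \<longleftrightarrow> cs = ?ord"
    proof
      assume "edge_path \<alpha> cs = edge_path \<alpha> ?ord"
      then have "map unit_deg cs = map unit_deg ?ord"
        using f f' unfolding is_factorization_def by metis
      then show "cs = ?ord" using inj_unit_deg by (simp add: inj_map_eq_map)
    qed simp
    ultimately show ?thesis by (simp add: comparison_retraction_def)
  qed
  have "frag_extend comparison_retraction (comparison_gen n g) = (\<Sum>cs\<in>permutations_of_set ?A.
      frag_cmul (inversion_sign cs) (if cs = ?ord then frag_of (Some (\<alpha>, \<mu>)) else 0))"
    unfolding cube(1,2) comparison_gen_cube[OF cube(3)] by (simp add: frag_extend_signed_sum r)
  also have "\<dots> = (\<Sum>cs\<in>permutations_of_set ?A. if cs = ?ord then frag_cmul (inversion_sign cs) (frag_of (Some (\<alpha>, \<mu>))) else 0)"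
    by (intro sum.cong) auto
  also have "\<dots> = frag_of (Some (\<alpha>, \<mu>))"
    using ord inversion_sign_sorted[OF strict_sorted_list_of_set[of ?A]] by simp
  finally show ?thesis using cube by simp
qed (simp add: comparison_gen_None comparison_retraction_def)

lemma comparison_injective:
  assumes "y \<in> carrier (grp (cubical_module \<Lambda> n) v)" "comparison \<Lambda> n v y = 0"
  shows "y = 0"
proof -
  have "frag_extend comparison_retraction (frag_extend (comparison_gen n) y) = frag_extend frag_of y"
    unfolding frag_extend_frag_extend
    using assms(1) by (intro frag_extend_eq) (auto simp: cubical_module_def retraction_comparison_on_generators)
  then show ?thesis
    using assms(2) frag_expansion[of y] by (simp add: comparison_eq)
qed

lemma cubical_boundary_closed:
  assumes "v \<in> verts \<Lambda>" "x \<in> carrier (grp (cubical_module \<Lambda> n) v)"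
  shows "cubical_boundary \<Lambda> n v x \<in> carrier (grp (cubical_module \<Lambda> (n - 1)) v)"
    "comparison \<Lambda> n v x \<in> carrier (grp (simplicial_module \<Lambda> n) v)"
  using assms cubical_boundary_module_map[of n] comparison_module_map[of n]
  by (auto simp only: module_map_def hom_def Pi_def)

text \<open>
  Since \<open>\<triangledown>\<close> commutes with the boundaries, it sends \<open>\<partial>\<partial>x\<close> to the twofold simplicial boundary of \<open>\<triangledown>x\<close>,
  which vanishes; so \<open>\<partial>\<partial>x\<close> lies in the kernel of an injective map.
\<close>

lemma cubical_boundary_boundary:
  assumes v: "v \<in> verts \<Lambda>" and x: "x \<in> carrier (grp (cubical_module \<Lambda> n) v)"
  shows "cubical_boundary \<Lambda> (n - 1) v (cubical_boundary \<Lambda> n v x) = 0"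
proof (rule comparison_injective)
  have x1: "cubical_boundary \<Lambda> n v x \<in> carrier (grp (cubical_module \<Lambda> (n - 1)) v)"
    using cubical_boundary_closed(1)[OF v x] .
  show "cubical_boundary \<Lambda> (n - 1) v (cubical_boundary \<Lambda> n v x) \<in> carrier (grp (cubical_module \<Lambda> (n - 1 - 1)) v)"
    using cubical_boundary_closed(1)[OF v x1] .
  have "comparison \<Lambda> (n - 1 - 1) v (cubical_boundary \<Lambda> (n - 1) v (cubical_boundary \<Lambda> n v x))
     = simplicial_boundary \<Lambda> (n - 1) v (simplicial_boundary \<Lambda> n v (comparison \<Lambda> n v x))"
    using comparison_boundary[OF x1] comparison_boundary[OF x] by simp
  also have "\<dots> = 0"
    using simplicial_boundary_boundary[OF cubical_boundary_closed(2)[OF v x]] .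
  finally show "comparison \<Lambda> (n - 1 - 1) v (cubical_boundary \<Lambda> (n - 1) v (cubical_boundary \<Lambda> n v x)) = 0" .
qed

lemma cubical_chain_complex: "chain_complex \<Lambda> (cubical_module \<Lambda>) (cubical_boundary \<Lambda>)"
  unfolding chain_complex_def
  using cubical_module_axioms cubical_boundary_module_map cubical_boundary_boundary
  by (simp add: cubical_module_def)

end

theorem proposition7p3:
  fixes k :: nat and \<Lambda> :: "'a kgraph"
  assumes "k_graph k \<Lambda>"
  shows "chain_map \<Lambda>
           (cubical_module \<Lambda>) (cubical_boundary \<Lambda>)
           (simplicial_module \<Lambda>) (simplicial_boundary \<Lambda>)
           (comparison \<Lambda>)"
proof -
  interpret k_graph k \<Lambda> by (rule assms)
  show ?thesis
    unfolding chain_map_def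
    using cubical_chain_complex simplicial_chain_complex comparison_module_map comparison_boundary
    by blast
qed

end
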